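(* Let $A\in\mathbb{R}^{n\times n}$, $B\in\mathbb{R}^{n\times m}$, let $Q\in\mathbb{R}^{n\times n}$, $R\in\mathbb{R}^{m\times m}$ be symmetric positive definite, $\gamma\in(0,1)$, $x\in\mathbb{R}^n$, and let $K\in\mathbb{R}^{m\times n}$ be such that $A_K:=A+BK$ satisfies $\rho(A_K)<1$. Let $(w_k)_{k\ge 0}$ be i.i.d. zero-mean Gaussian random vectors in $\mathbb{R}^n$ with positive definite covariance matrix $\Sigma$. Let $P$ be the unique solution of $P=Q+K^\top RK+\gamma A_K^\top PA_K$, let $Z$ be the unique solution of $$Z-\gamma^2A_KZA_K^\top=A_K\Big(xx^\top+\frac{\gamma^2}{1-\gamma^2}\Sigma\Big)A_K^\top ,$$ and let $G^K(x)$ be the random return defined in the context. Then $$\operatorname{Var}[G^K(x)]=\frac{2\gamma^2}{1-\gamma^2}\operatorname{tr}(P\Sigma P\Sigma)+4\gamma^2\operatorname{tr}(P\Sigma PZ).$$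
   Context: $\rho(\cdot)$ denotes the spectral radius. The random return of the closed-loop system $x_{t+1}=A_Kx_t+v_t$, $x_0=x$ (with $v_t$ i.i.d. with the same law as $w_k$), namely $\sum_{t\ge0}\gamma^t x_t^\top(Q+K^\top RK)x_t$, is represented (equal in distribution) by $$G^K(x)=x^\top Px+2\sum_{k=0}^{\infty}\gamma^{k+1}w_k^\top PA_K^{k+1}x+\sum_{k=0}^{\infty}\gamma^{k+1}w_k^\top Pw_k+2\sum_{k=1}^{\infty}\gamma^{k+1}w_k^\top P\sum_{\tau=0}^{k-1}A_K^{k-\tau}w_\tau ,$$ and $G^K(x)$ denotes this random variable. *)

theory Defs
  imports "HOL-Probability.Probability"
begin

definition pos_def :: "real^'n^'n \<Rightarrow> bool" where
  "pos_def S \<longleftrightarrow> transpose S = S \<and> (\<forall>v. v \<noteq> 0 \<longrightarrow> v \<bullet> (S *v v) > 0)"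

(* The overloaded power on real^'n^'n would be taken entrywise, hence a separate constant. *)
definition matpow :: "real^'n^'n \<Rightarrow> nat \<Rightarrow> real^'n^'n" where
  "matpow A k = (((**) A) ^^ k) (mat 1)"

definition complex_eigenvalues :: "real^'n^'n \<Rightarrow> complex set" where
  "complex_eigenvalues A =
     {c. \<exists>v. v \<noteq> 0 \<and> map_matrix complex_of_real A *v v = c *s v}"

(* The set of eigenvalues is finite and nonempty, so the supremum is a maximum. *)
definition spectral_radius :: "real^'n^'n \<Rightarrow> real" where
  "spectral_radius A = (SUP c\<in>complex_eigenvalues A. cmod c)"

definition outer_product :: "real^'n \<Rightarrow> real^'n \<Rightarrow> real^'n^'n" where
  "outer_product u v = (\<chi> i j. u $ i * v $ j)"

(* A random vector is Gaussian if every linear functional of it is univariate normal,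
   where a point mass counts as a normal distribution with zero variance. *)
definition gaussian_vector :: "'a measure \<Rightarrow> ('a \<Rightarrow> real^'n) \<Rightarrow> bool" where
  "gaussian_vector M X \<longleftrightarrow> X \<in> borel_measurable M \<and>
     (\<forall>a. \<exists>\<mu> \<sigma>. 0 \<le> \<sigma> \<and> distr M borel (\<lambda>\<omega>. a \<bullet> X \<omega>) =
        (if \<sigma> = 0 then return borel \<mu> else density lborel (\<lambda>t. ennreal (normal_density \<mu> \<sigma> t))))"

definition covariance_matrix :: "'a measure \<Rightarrow> ('a \<Rightarrow> real^'n) \<Rightarrow> real^'n^'n" where
  "covariance_matrix M X = (\<chi> i j. \<integral>\<omega>. (X \<omega> $ i - (\<integral>\<omega>'. X \<omega>' \<partial>M) $ i) *
                                      (X \<omega> $ j - (\<integral>\<omega>'. X \<omega>' \<partial>M) $ j) \<partial>M)"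

definition is_P_solution ::
  "real^'n^'n \<Rightarrow> real^'m^'n \<Rightarrow> real^'n^'n \<Rightarrow> real^'m^'m \<Rightarrow> real \<Rightarrow> real^'n^'m \<Rightarrow>
   real^'n^'n \<Rightarrow> bool" where
  "is_P_solution A B Q R \<gamma> K P \<longleftrightarrow>
     P = Q + transpose K ** R ** K
           + \<gamma> *\<^sub>R (transpose (A + B ** K) ** P ** (A + B ** K))"

definition is_Z_solution ::
  "real^'n^'n \<Rightarrow> real^'m^'n \<Rightarrow> real \<Rightarrow> real^'n^'m \<Rightarrow> real^'n^'n \<Rightarrow> real^'n \<Rightarrow>
   real^'n^'n \<Rightarrow> bool" where
  "is_Z_solution A B \<gamma> K S x Z \<longleftrightarrow>
     Z - \<gamma>\<^sup>2 *\<^sub>R ((A + B ** K) ** Z ** transpose (A + B ** K))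
     = (A + B ** K) ** (outer_product x x + (\<gamma>\<^sup>2 / (1 - \<gamma>\<^sup>2)) *\<^sub>R S) ** transpose (A + B ** K)"

(* The summands of the three series, evaluated at one realisation w of the noise sequence;
   F is the closed-loop matrix. *)
definition return_term1 ::
  "real \<Rightarrow> real^'n^'n \<Rightarrow> real^'n^'n \<Rightarrow> real^'n \<Rightarrow> (nat \<Rightarrow> real^'n) \<Rightarrow> nat \<Rightarrow> real" where
  "return_term1 \<gamma> P F x w k = \<gamma> ^ (k + 1) * (w k \<bullet> (P *v (matpow F (k + 1) *v x)))"

definition return_term2 ::
  "real \<Rightarrow> real^'n^'n \<Rightarrow> (nat \<Rightarrow> real^'n) \<Rightarrow> nat \<Rightarrow> real" where
  "return_term2 \<gamma> P w k = \<gamma> ^ (k + 1) * (w k \<bullet> (P *v w k))"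

definition return_term3 ::
  "real \<Rightarrow> real^'n^'n \<Rightarrow> real^'n^'n \<Rightarrow> (nat \<Rightarrow> real^'n) \<Rightarrow> nat \<Rightarrow> real" where
  "return_term3 \<gamma> P F w k =
     \<gamma> ^ (k + 1) * (w k \<bullet> (P *v (\<Sum>\<tau><k. matpow F (k - \<tau>) *v w \<tau>)))"

(* The third series starts at index 1, hence the shift. *)
definition random_return ::
  "real \<Rightarrow> real^'n^'n \<Rightarrow> real^'n^'n \<Rightarrow> real^'n \<Rightarrow> (nat \<Rightarrow> 'a \<Rightarrow> real^'n) \<Rightarrow> 'a \<Rightarrow> real" where
  "random_return \<gamma> P F x w \<omega> =
     x \<bullet> (P *v x)
     + 2 * (\<Sum>k. return_term1 \<gamma> P F x (\<lambda>j. w j \<omega>) k)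
     + (\<Sum>k. return_term2 \<gamma> P (\<lambda>j. w j \<omega>) k)
     + 2 * (\<Sum>k. return_term3 \<gamma> P F (\<lambda>j. w j \<omega>) (Suc k))"

end

theory Submission
  imports Defs "HOL-Complex_Analysis.Laurent_Convergence"
begin

text \<open>Write \<open>F = A + B K\<close> and let \<open>y\<^sub>0 = F x\<close>, \<open>y\<^sub>k\<^sub>+\<^sub>1 = F (y\<^sub>k + w\<^sub>k)\<close>. Collecting the terms of the three series with
  the same leading \<open>w\<^sub>k\<close>, the centered return is \<open>\<Sum>k. \<gamma>^(k+1) \<xi>\<^sub>k\<close> with
  \<open>\<xi>\<^sub>k = w\<^sub>k \<bullet> P w\<^sub>k - tr (P \<Sigma>) + 2 w\<^sub>k \<bullet> P y\<^sub>k\<close>. As \<open>y\<^sub>k\<close> is a function of \<open>w\<^sub>0, \<dots>, w\<^sub>k\<^sub>-\<^sub>1\<close>, the \<open>\<xi>\<^sub>k\<close> are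
  orthogonal, and since third moments vanish Isserlis' formula gives
  \<open>E \<xi>\<^sub>k\<^sup>2 = 2 tr (P \<Sigma> P \<Sigma>) + 4 tr (P \<Sigma> P Y\<^sub>k)\<close> with \<open>Y\<^sub>k = E (y\<^sub>k y\<^sub>k\<^sup>T)\<close>. The recursion
  \<open>Y\<^sub>k\<^sub>+\<^sub>1 = F (Y\<^sub>k + \<Sigma>) F\<^sup>T\<close> shows that \<open>\<Sum>k. \<gamma>^(2k) Y\<^sub>k\<close> solves the equation that defines \<open>Z\<close>.
  Convergence and unique solvability use only that the powers of \<open>F\<close> are bounded.\<close>

no_notation fps_nth (infixl \<open>$\<close> 75)

section \<open>Powers of a matrix of spectral radius less than one\<close>

text \<open>Compare the sums of the moduli of the entries on both sides of \<open>A v = c v\<close>.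
  The bound makes the set of eigenvalue moduli bounded above, so that the supremum in
  \<open>spectral_radius\<close> really dominates each of them.\<close>

lemma cmod_eigenvalue_le:
  assumes "c \<in> complex_eigenvalues A"
  shows "cmod c \<le> (\<Sum>i\<in>UNIV. \<Sum>j\<in>UNIV. \<bar>A $ i $ j\<bar>)"
proof -
  obtain v where v: "v \<noteq> 0" "map_matrix complex_of_real A *v v = c *s v"
    using assms by (auto simp: complex_eigenvalues_def)
  define s where "s = (\<Sum>i\<in>UNIV. cmod (v $ i))"
  have le: "cmod (v $ j) \<le> s" for j
    unfolding s_def by (rule member_le_sum) auto
  obtain i where "v $ i \<noteq> 0"
    using v(1) by (auto simp: vec_eq_iff)
  then have "s > 0"
    using le[of i] by (smt (verit) zero_less_norm_iff)
  have "cmod c * s = (\<Sum>i\<in>UNIV. cmod ((map_matrix complex_of_real A *v v) $ i))"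
    by (simp add: v(2) s_def sum_distrib_left norm_mult)
  also have "\<dots> \<le> (\<Sum>i\<in>UNIV. \<Sum>j\<in>UNIV. \<bar>A $ i $ j\<bar> * s)"
    unfolding matrix_vector_mult_def vec_lambda_beta
    by (intro sum_mono order.trans[OF norm_sum])
       (auto simp: norm_mult map_matrix_def intro!: mult_left_mono le)
  also have "\<dots> = (\<Sum>i\<in>UNIV. \<Sum>j\<in>UNIV. \<bar>A $ i $ j\<bar>) * s"
    by (simp add: sum_distrib_right)
  finally show ?thesis
    using \<open>s > 0\<close> by simp
qed

lemma cmod_le_spectral_radius:
  assumes "c \<in> complex_eigenvalues A"
  shows "cmod c \<le> spectral_radius A"
  unfolding spectral_radius_def
  by (rule cSUP_upper[OF assms]) (auto simp: bdd_above_def intro: cmod_eigenvalue_le)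

lemma matpow_0 [simp]: "matpow A 0 = mat 1"
  by (simp add: matpow_def)

lemma matpow_Suc: "matpow A (Suc k) = A ** matpow A k"
  by (simp add: matpow_def)

text \<open>The entries of the resolvent \<open>(1 - z A)\<inverse>\<close> are, by Cramer's rule, holomorphic on a disc of
  radius greater than 1; their Taylor coefficients are the entries of the powers of \<open>A\<close>.\<close>

lemma matpow_bounded:
  fixes A :: "real^'n^'n"
  assumes "spectral_radius A < 1"
  shows "\<exists>C. \<forall>k i j. \<bar>matpow A k $ i $ j\<bar> \<le> C"
proof -
  \<comment> \<open>The spectral radius may be 0; the maximum with 1/2 keeps \<open>1 / r\<close>
    meaningful while still \<open>1 / r > 1\<close>.\<close>
  define r where "r = max (spectral_radius A) (1/2)"
  have r: "0 < r" "r < 1" "spectral_radius A \<le> r"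
    using assms by (auto simp: r_def)
  define D where "D = ball (0::complex) (1 / r)"
  \<comment> \<open>This is \<open>I - z A\<close>. If it is singular, then \<open>z\<close> is
    nonzero and \<open>1 / z\<close> is an eigenvalue of \<open>A\<close>.\<close>
  define W where "W = (\<lambda>z::complex. (\<chi> i j. of_bool (i = j) - z * complex_of_real (A $ i $ j)) :: complex^'n^'n)"
  have W_mult: "(W z *v v) $ i = v $ i - z * (map_matrix complex_of_real A *v v) $ i" for z v i
    by (simp add: W_def matrix_vector_mult_def left_diff_distrib sum_subtractf sum_distrib_left
        mult.assoc map_matrix_def of_bool_def if_distrib[of "\<lambda>x. x * _"] cong: if_cong)
  have det: "det (W z) \<noteq> 0" if "z \<in> D" for z
  proof
    assume "det (W z) = 0"
    then obtain v where v: "v \<noteq> 0" "W z *v v = 0"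
      using matrix_left_invertible_ker[of "W z"] invertible_left_inverse[of "W z"] invertible_det_nz[of "W z"]
      by auto
    have eq: "v $ i = z * (map_matrix complex_of_real A *v v) $ i" for i
      using W_mult[of z v i] v(2) by simp
    then have "z \<noteq> 0"
      using v(1) by (auto simp: vec_eq_iff)
    then have "map_matrix complex_of_real A *v v = (1 / z) *s v"
      using eq by (simp add: vec_eq_iff)
    then have "1 / z \<in> complex_eigenvalues A"
      using v(1) by (auto simp: complex_eigenvalues_def)
    then have "cmod (1 / z) \<le> r"
      using cmod_le_spectral_radius r by force
    with that r \<open>z \<noteq> 0\<close> show False
      by (simp add: D_def norm_divide field_simps)
  qed
  \<comment> \<open>Cramer's quotient for coordinate \<open>i\<close> of the solution of
    \<open>W z v = e_j\<close>, that is, entry \<open>(i, j)\<close> of the resolvent.\<close>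
  define f where "f = (\<lambda>j i z. det (\<chi> a b. if b = i then axis j 1 $ a else W z $ a $ b) / det (W z))"
  \<comment> \<open>The resolvent identity \<open>R = I + z A R\<close>, entry by entry. It carries
    over to the Taylor series.\<close>
  have f_eq: "f j i z = of_bool (i = j) + z * (\<Sum>l\<in>UNIV. complex_of_real (A $ i $ l) * f j l z)"
    if "z \<in> D" for j i z
  proof -
    have "W z *v (\<chi> i. f j i z) = axis j 1"
      using cramer[OF det[OF that], of "\<chi> i. f j i z" "axis j 1"] by (simp add: f_def)
    then have "(W z *v (\<chi> i. f j i z)) $ i = of_bool (i = j)"
      by (simp add: axis_def)
    then show ?thesis
      unfolding W_mult by (simp add: matrix_vector_mult_def map_matrix_def algebra_simps)
  qed
  have holo: "f j i holomorphic_on D" for i j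
  proof -
    have W': "(\<lambda>z. if b = i then axis j 1 $ a else W z $ a $ b) holomorphic_on D" for a b
      by (cases "b = i") (auto simp: W_def intro!: holomorphic_intros)
    have W'': "(\<lambda>z. W z $ a $ b) holomorphic_on D" for a b
      by (auto simp: W_def intro!: holomorphic_intros)
    have "(\<lambda>z. det (\<chi> a b. if b = i then axis j 1 $ a else W z $ a $ b) / det (W z)) holomorphic_on D"
      by (rule holomorphic_on_divide[OF _ _ det])
         (auto simp only: det_def vec_lambda_beta intro!: holomorphic_intros W' W'')
    then show ?thesis
      by (simp add: f_def)
  qed
  have D: "open D" "0 \<in> D"
    using r by (auto simp: D_def)
  define E where "E = (\<lambda>j i. fps_expansion (f j i) 0)"
  have E: "f j i has_fps_expansion E j i" for i j
    unfolding E_def by (rule has_fps_expansion_fps_expansion[OF D holo])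
  have E_eq: "E j i = fps_const (of_bool (i = j)) + fps_X * (\<Sum>l\<in>UNIV. fps_const (complex_of_real (A $ i $ l)) * E j l)" for i j
  proof -
    have "(\<lambda>z. of_bool (i = j) + z * (\<Sum>l\<in>UNIV. complex_of_real (A $ i $ l) * f j l z))
      has_fps_expansion fps_const (of_bool (i = j)) + fps_X * (\<Sum>l\<in>UNIV. fps_const (complex_of_real (A $ i $ l)) * E j l)"
      by (intro fps_expansion_intros E)
    also have "?this \<longleftrightarrow> f j i has_fps_expansion fps_const (of_bool (i = j)) + fps_X * (\<Sum>l\<in>UNIV. fps_const (complex_of_real (A $ i $ l)) * E j l)"
      using eventually_nhds_in_open[OF D] f_eq
      by (intro has_fps_expansion_cong) (auto elim!: eventually_mono)
    finally show ?thesis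
      using fps_expansion_unique_complex E by blast
  qed
  \<comment> \<open>Comparing coefficients in \<open>E_eq\<close> gives the recursion of
    \<open>matpow_Suc\<close>.\<close>
  have nth: "fps_nth (E j i) n = complex_of_real (matpow A n $ i $ j)" for i j n
  proof (induction n arbitrary: i)
    case 0
    show ?case by (subst E_eq) (simp add: mat_def)
  next
    case (Suc n)
    show ?case
      by (subst E_eq) (simp add: fps_sum_nth Suc matpow_Suc matrix_matrix_mult_def)
  qed
  have "\<exists>c. \<forall>n. \<bar>matpow A n $ i $ j\<bar> \<le> c" for i j
  proof -
    have "fps_conv_radius (E j i) \<ge> ereal (1 / r)"
      unfolding E_def by (rule conv_radius_fps_expansion) (use holo in \<open>simp add: D_def\<close>)
    \<comment> \<open>Since 1 lies strictly inside the disc of convergence, the coefficients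
      themselves form a summable sequence, which is therefore bounded.\<close>
    moreover have "ereal (norm (1::complex)) < ereal (1 / r)"
      using r by simp
    ultimately have "summable (\<lambda>n. fps_nth (E j i) n * 1 ^ n)"
      by (intro summable_fps) (rule less_le_trans)
    then have "summable (\<lambda>n. complex_of_real (matpow A n $ i $ j))"
      by (simp add: nth)
    then have "Bseq (\<lambda>n. complex_of_real (matpow A n $ i $ j))"
      by (intro convergent_imp_Bseq) (use summable_LIMSEQ_zero convergentI in blast)
    then show ?thesis
      by (auto simp: Bseq_def)
  qed
  then obtain c where c: "\<bar>matpow A n $ i $ j\<bar> \<le> c i j" for n i j
    by metis
  have "\<bar>matpow A n $ i $ j\<bar> \<le> (\<Sum>i\<in>UNIV. \<Sum>j\<in>UNIV. \<bar>c i j\<bar>)" for n i j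
  proof -
    have "\<bar>matpow A n $ i $ j\<bar> \<le> \<bar>c i j\<bar>"
      using c[of n i j] by linarith
    also have "\<dots> \<le> (\<Sum>j\<in>UNIV. \<bar>c i j\<bar>)"
      by (rule member_le_sum) auto
    also have "\<dots> \<le> (\<Sum>i\<in>UNIV. \<Sum>j\<in>UNIV. \<bar>c i j\<bar>)"
      by (rule member_le_sum[of i UNIV "\<lambda>i. \<Sum>j\<in>UNIV. \<bar>c i j\<bar>"]) (auto intro: sum_nonneg)
    finally show ?thesis .
  qed
  then show ?thesis
    by blast
qed

section \<open>Discounted linear matrix equations\<close>

lemma transpose_scaleR: "transpose (c *\<^sub>R X) = c *\<^sub>R transpose (X :: real^'n^'m)"
  by (simp add: transpose_def vec_eq_iff)

lemma transpose_add: "transpose (X + Y) = transpose X + transpose (Y :: real^'n^'m)"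
  by (simp add: transpose_def vec_eq_iff)

lemma matpow_commute: "matpow A k ** A = A ** matpow A k"
  by (induction k) (simp_all add: matpow_Suc flip: matrix_mul_assoc)

lemma transpose_matpow: "transpose (matpow A k) = matpow (transpose A) k"
  by (induction k) (simp_all add: matpow_Suc matrix_transpose_mul matpow_commute)

lemma congruence_nth:
  "(N ** X ** transpose N) $ i $ j = (\<Sum>a\<in>UNIV. \<Sum>b\<in>UNIV. N $ i $ a * N $ j $ b * X $ a $ (b::'n::finite))"
  for N X :: "real^'n^'n"
proof -
  have "(N ** X ** transpose N) $ i $ j = (\<Sum>b\<in>UNIV. \<Sum>a\<in>UNIV. N $ i $ a * N $ j $ b * X $ a $ b)"
    by (simp add: matrix_matrix_mult_def transpose_def sum_distrib_left sum_distrib_right mult_ac)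
  then show ?thesis
    by (subst sum.swap)
qed

text \<open>\<open>N\<close> enters only through the entry bound \<open>C\<close>, so the estimate
  is uniform over all powers of a matrix whose powers are bounded.\<close>

lemma norm_congruence_le:
  fixes N X :: "real^'n^'n"
  assumes "\<And>i j. \<bar>N $ i $ j\<bar> \<le> C"
  shows "norm (N ** X ** transpose N) \<le> (real CARD('n))\<^sup>2 * (C\<^sup>2 * (\<Sum>a\<in>UNIV. \<Sum>b\<in>UNIV. \<bar>X $ a $ b\<bar>))"
proof -
  have entry: "\<bar>(N ** X ** transpose N) $ i $ j\<bar> \<le> C\<^sup>2 * (\<Sum>a\<in>UNIV. \<Sum>b\<in>UNIV. \<bar>X $ a $ b\<bar>)" for i j
    unfolding congruence_nth sum_distrib_left
    by (intro order.trans[OF sum_abs] sum_mono)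
       (auto simp: abs_mult power2_eq_square intro!: mult_right_mono mult_mono assms order.trans[OF abs_ge_zero assms])
  have "norm (N ** X ** transpose N) \<le> (\<Sum>i\<in>UNIV. \<Sum>j\<in>UNIV. \<bar>(N ** X ** transpose N) $ i $ j\<bar>)"
    unfolding norm_vec_def[of "N ** X ** transpose N"]
    by (intro order.trans[OF L2_set_le_sum] sum_mono norm_le_l1_cart) auto
  also have "\<dots> \<le> (\<Sum>i\<in>(UNIV::'n set). \<Sum>j\<in>(UNIV::'n set). C\<^sup>2 * (\<Sum>a\<in>UNIV. \<Sum>b\<in>UNIV. \<bar>X $ a $ b\<bar>))"
    by (intro sum_mono entry)
  finally show ?thesis
    by (simp add: power2_eq_square mult.assoc)
qed

lemma matpow_congruence_step:
  "N ** (matpow N k ** X ** transpose (matpow N k)) ** transpose N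
    = matpow N (Suc k) ** X ** transpose (matpow N (Suc k))"
  by (simp add: matpow_Suc matrix_transpose_mul matrix_mul_assoc)

lemma matrix_mul_add_rdistrib: "(X + Y) ** W = X ** W + Y ** (W :: real^'n^'m)"
  by (simp add: matrix_matrix_mult_def vec_eq_iff sum.distrib distrib_right)

lemma matrix_mul_scaleR_left: "(c *\<^sub>R X) ** Y = c *\<^sub>R (X ** (Y::real^'n^'m))"
  and matrix_mul_scaleR_right: "X ** (c *\<^sub>R Y) = c *\<^sub>R (X ** (Y::real^'n^'m))"
  by (simp_all add: matrix_matrix_mult_def vec_eq_iff sum_distrib_left mult_ac)

text \<open>Iterating the equation \<open>k\<close> times puts the factor \<open>c ^ k\<close> in
  front of a congruence by the \<open>k\<close>-th power of \<open>N\<close>, whose norm is bounded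
  independently of \<open>k\<close>.\<close>

lemma discounted_fixpoint_0:
  fixes N D :: "real^'n^'n"
  assumes bd: "\<And>k i j. \<bar>matpow N k $ i $ j\<bar> \<le> C" and c: "0 \<le> c" "c < 1"
    and D: "D = c *\<^sub>R (N ** D ** transpose N)"
  shows "D = 0"
proof -
  have eq: "D = c ^ k *\<^sub>R (matpow N k ** D ** transpose (matpow N k))" for k
  proof (induction k)
    case (Suc k)
    have "D = c *\<^sub>R (N ** D ** transpose N)"
      by (rule D)
    also have "\<dots> = c *\<^sub>R (N ** (c ^ k *\<^sub>R (matpow N k ** D ** transpose (matpow N k))) ** transpose N)"
      by (rule arg_cong[OF Suc.IH, of "\<lambda>D. c *\<^sub>R (N ** D ** transpose N)"])
    also have "\<dots> = c ^ Suc k *\<^sub>R (N ** (matpow N k ** D ** transpose (matpow N k)) ** transpose N)"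
      by (simp only: matrix_mul_scaleR_left matrix_mul_scaleR_right scaleR_scaleR power_Suc)
    finally show ?case
      unfolding matpow_congruence_step .
  qed (simp add: matrix_mul_lid matrix_mul_rid)
  define L where "L = (real CARD('n))\<^sup>2 * (C\<^sup>2 * (\<Sum>a\<in>UNIV. \<Sum>b\<in>UNIV. \<bar>D $ a $ b\<bar>))"
  have "norm D \<le> c ^ k * L" for k
  proof -
    have "norm D = c ^ k * norm (matpow N k ** D ** transpose (matpow N k))"
      using arg_cong[OF eq[of k], of norm] c by simp
    also have "\<dots> \<le> c ^ k * L"
      unfolding L_def using c by (intro mult_left_mono norm_congruence_le bd) auto
    finally show ?thesis .
  qed
  moreover have "(\<lambda>k. c ^ k * L) \<longlonglongrightarrow> 0"
    using tendsto_mult_left_zero[OF LIMSEQ_realpow_zero[OF c]] .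
  ultimately have "norm D \<le> 0"
    using LIMSEQ_le_const by blast
  then show ?thesis
    by simp
qed

text \<open>An injective linear map of a finite-dimensional space to itself is bijective, and the
  kernel is trivial by \<open>discounted_fixpoint_0\<close>. With \<open>N = F\<close> this serves
  the equation of \<open>Z\<close>, with \<open>N\<close> the transpose of \<open>F\<close> that of
  \<open>P\<close>.\<close>

lemma discounted_equation_ex1:
  fixes N S :: "real^'n^'n"
  assumes bd: "\<And>k i j. \<bar>matpow N k $ i $ j\<bar> \<le> C" and c: "0 \<le> c" "c < 1"
  shows "\<exists>!X. X - c *\<^sub>R (N ** X ** transpose N) = S"
proof -
  define L where "L = (\<lambda>X. X - c *\<^sub>R (N ** X ** transpose N))"
  have lin: "linear L"
    unfolding L_def
    by (intro linearI) (simp_all add: matrix_add_ldistrib matrix_mul_add_rdistrib matrix_mul_scaleR_left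
        matrix_mul_scaleR_right scaleR_diff_right scaleR_add_right mult.commute)
  have inj: "inj L"
    unfolding linear_injective_0[OF lin] using discounted_fixpoint_0[OF bd c] by (auto simp: L_def)
  have "surj L"
    by (rule linear_injective_imp_surjective[OF lin inj]) simp
  with inj have "bij L"
    by (simp add: bij_def)
  then show ?thesis
    unfolding bij_iff L_def by blast
qed

section \<open>Discounted series of orthogonal random variables\<close>

lemma abs_mult_le_squares: "\<bar>a * b\<bar> \<le> a\<^sup>2 + b\<^sup>2" for a b :: real
proof -
  have "2 * \<bar>a\<bar> * \<bar>b\<bar> \<le> a\<^sup>2 + b\<^sup>2"
    using sum_squares_bound[of "\<bar>a\<bar>" "\<bar>b\<bar>"] by simp
  moreover have "0 \<le> \<bar>a\<bar> * \<bar>b\<bar>"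
    by simp
  ultimately show ?thesis
    unfolding abs_mult by linarith
qed

text \<open>By weighted Cauchy--Schwarz. The bound is uniform in \<open>n\<close>, so that it can serve as an integrable
  majorant of the squared partial sums.\<close>

lemma discounted_sum_power2_le:
  fixes a :: "nat \<Rightarrow> real"
  assumes g: "0 < \<gamma>" "\<gamma> < 1" and s: "summable (\<lambda>k. \<gamma> ^ (k + 1) * (a k)\<^sup>2)"
  shows "(\<Sum>k<n. \<gamma> ^ (k + 1) * a k)\<^sup>2 \<le> \<gamma> / (1 - \<gamma>) * (\<Sum>k. \<gamma> ^ (k + 1) * (a k)\<^sup>2)"
proof -
  have *: "(\<lambda>k. \<gamma> ^ (k + 1)) sums (\<gamma> / (1 - \<gamma>))"
    using sums_mult[OF geometric_sums[of \<gamma>], of \<gamma>] g by simp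
  \<comment> \<open>The weight is split evenly: one square root goes into each factor of the
    Cauchy--Schwarz inequality.\<close>
  have "(\<Sum>k<n. \<gamma> ^ (k + 1) * a k)\<^sup>2 = (\<Sum>k<n. sqrt (\<gamma> ^ (k + 1)) * (sqrt (\<gamma> ^ (k + 1)) * a k))\<^sup>2"
    using g by (intro arg_cong[where f = "\<lambda>x. x\<^sup>2"] sum.cong) (auto simp flip: mult.assoc)
  also have "\<dots> \<le> (\<Sum>k<n. (sqrt (\<gamma> ^ (k + 1)))\<^sup>2) * (\<Sum>k<n. (sqrt (\<gamma> ^ (k + 1)) * a k)\<^sup>2)"
    by (rule Cauchy_Schwarz_ineq_sum)
  also have "\<dots> = (\<Sum>k<n. \<gamma> ^ (k + 1)) * (\<Sum>k<n. \<gamma> ^ (k + 1) * (a k)\<^sup>2)"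
    using g by (simp add: power_mult_distrib)
  also have "\<dots> \<le> \<gamma> / (1 - \<gamma>) * (\<Sum>k. \<gamma> ^ (k + 1) * (a k)\<^sup>2)"
    unfolding sums_unique[OF *]
    using g by (intro mult_mono sum_le_suminf sums_summable[OF *] s) (auto intro!: sum_nonneg suminf_nonneg sums_summable[OF *])
  finally show ?thesis .
qed

text \<open>Since \<open>\<bar>a\<bar> \<le> 1 + a\<^sup>2\<close>, the terms are dominated by a
  geometric series plus the given one.\<close>

lemma discounted_summable:
  fixes a :: "nat \<Rightarrow> real"
  assumes g: "0 < \<gamma>" "\<gamma> < 1" and s: "summable (\<lambda>k. \<gamma> ^ (k + 1) * (a k)\<^sup>2)"
  shows "summable (\<lambda>k. \<gamma> ^ (k + 1) * a k)"
proof (rule summable_comparison_test')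
  have "summable (\<lambda>k. \<gamma> ^ (k + 1))"
    using sums_summable[OF sums_mult[OF geometric_sums[of \<gamma>], of \<gamma>]] g by simp
  then show "summable (\<lambda>k. \<gamma> ^ (k + 1) + \<gamma> ^ (k + 1) * (a k)\<^sup>2)"
    by (intro summable_add s)
  show "norm (\<gamma> ^ (k + 1) * a k) \<le> \<gamma> ^ (k + 1) + \<gamma> ^ (k + 1) * (a k)\<^sup>2" for k
  proof -
    have "\<bar>a k\<bar> \<le> 1 + (a k)\<^sup>2"
      using sum_squares_bound[of 1 "\<bar>a k\<bar>"] by (simp add: power2_eq_square)
    then show ?thesis
      using g mult_left_mono[of "\<bar>a k\<bar>" "1 + (a k)\<^sup>2" "\<gamma> ^ (k + 1)"] by (simp add: abs_mult algebra_simps)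
  qed
qed

text \<open>By monotone convergence the sum of the \<open>f k\<close> has a finite integral, hence
  is finite almost everywhere.\<close>

lemma AE_summable_of_summable_integral:
  fixes f :: "nat \<Rightarrow> 'a \<Rightarrow> real"
  assumes int: "\<And>k. integrable M (f k)" and nn: "\<And>k \<omega>. 0 \<le> f k \<omega>"
    and s: "summable (\<lambda>k. \<integral>\<omega>. f k \<omega> \<partial>M)"
  shows "AE \<omega> in M. summable (\<lambda>k. f k \<omega>)"
proof -
  have [measurable]: "f k \<in> borel_measurable M" for k
    using int by simp
  have "(\<integral>\<^sup>+ \<omega>. (\<Sum>k. ennreal (f k \<omega>)) \<partial>M) = (\<Sum>k. \<integral>\<^sup>+ \<omega>. ennreal (f k \<omega>) \<partial>M)"
    by (intro nn_integral_suminf) auto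
  also have "\<dots> = (\<Sum>k. ennreal (\<integral>\<omega>. f k \<omega> \<partial>M))"
    by (intro suminf_cong nn_integral_eq_integral int) (simp add: nn)
  also have "\<dots> < \<infinity>"
    using s by (simp add: ennreal_suminf_neq_top less_top[symmetric] integral_nonneg_AE nn)
  finally have "AE \<omega> in M. (\<Sum>k. ennreal (f k \<omega>)) \<noteq> \<infinity>"
    by (intro nn_integral_PInf_AE) auto
  then show ?thesis
    by eventually_elim (auto intro: summable_suminf_not_top nn)
qed

context
  fixes M :: "'a measure" and \<xi> :: "nat \<Rightarrow> 'a \<Rightarrow> real" and \<gamma> :: real
  assumes g: "0 < \<gamma>" "\<gamma> < 1"
    and \<xi> [measurable]: "\<And>k. \<xi> k \<in> borel_measurable M"
    and sq: "\<And>k. integrable M (\<lambda>\<omega>. (\<xi> k \<omega>)\<^sup>2)"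
    and s: "summable (\<lambda>k. \<gamma> ^ (k + 1) * (\<integral>\<omega>. (\<xi> k \<omega>)\<^sup>2 \<partial>M))"
begin

lemma AE_discounted_squares_summable: "AE \<omega> in M. summable (\<lambda>k. \<gamma> ^ (k + 1) * (\<xi> k \<omega>)\<^sup>2)"
  by (rule AE_summable_of_summable_integral) (use g s in \<open>auto intro!: sq\<close>)

lemma AE_discounted_summable: "AE \<omega> in M. summable (\<lambda>k. \<gamma> ^ (k + 1) * \<xi> k \<omega>)"
  using AE_discounted_squares_summable by eventually_elim (rule discounted_summable[OF g])

text \<open>Dominated convergence for the partial sums and for their squares. Orthogonality removes
  the mixed terms from the second moment of each partial sum, and the limit gives the series of
  second moments.\<close>

lemma discounted_orthogonal_series:
  assumes M: "prob_space M"
    and mean: "\<And>k. (\<integral>\<omega>. \<xi> k \<omega> \<partial>M) = 0"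
    and orth: "\<And>k l. l < k \<Longrightarrow> (\<integral>\<omega>. \<xi> k \<omega> * \<xi> l \<omega> \<partial>M) = 0"
  defines "S \<equiv> (\<lambda>\<omega>. \<Sum>k. \<gamma> ^ (k + 1) * \<xi> k \<omega>)"
  shows "integrable M S" "integrable M (\<lambda>\<omega>. (S \<omega>)\<^sup>2)" "(\<integral>\<omega>. S \<omega> \<partial>M) = 0"
    and "(\<lambda>k. \<gamma> ^ (2 * (k + 1)) * (\<integral>\<omega>. (\<xi> k \<omega>)\<^sup>2 \<partial>M)) sums (\<integral>\<omega>. (S \<omega>)\<^sup>2 \<partial>M)"
proof -
  interpret prob_space M by fact
  \<comment> \<open>The majorant of all squared partial sums from
    \<open>discounted_sum_power2_le\<close>. Its integrability is the reason why \<open>s\<close>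
    carries the weight \<open>\<gamma> ^ (k + 1)\<close> and not its square.\<close>
  define J where "J = (\<lambda>\<omega>. \<gamma> / (1 - \<gamma>) * (\<Sum>k. \<gamma> ^ (k + 1) * (\<xi> k \<omega>)\<^sup>2))"
  have J: "integrable M J"
    unfolding J_def
    by (intro integrable_mult_right integrable_suminf)
       (use g s AE_discounted_squares_summable in \<open>auto intro!: sq simp: abs_mult\<close>)
  define T where "T = (\<lambda>n \<omega>. \<Sum>k<n. \<gamma> ^ (k + 1) * \<xi> k \<omega>)"
  have [measurable]: "T n \<in> borel_measurable M" "S \<in> borel_measurable M" for n
    by (simp_all add: T_def S_def)
  have lim: "AE \<omega> in M. (\<lambda>n. T n \<omega>) \<longlonglongrightarrow> S \<omega>"
    using AE_discounted_summable
    by eventually_elim (auto simp: T_def S_def intro: summable_LIMSEQ)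
  then have lim2: "AE \<omega> in M. (\<lambda>n. (T n \<omega>)\<^sup>2) \<longlonglongrightarrow> (S \<omega>)\<^sup>2"
    by eventually_elim (rule tendsto_power)
  have bound2: "AE \<omega> in M. norm ((T n \<omega>)\<^sup>2) \<le> J \<omega>" for n
    using AE_discounted_squares_summable
    by eventually_elim (use discounted_sum_power2_le[OF g] in \<open>auto simp: T_def J_def\<close>)
  have abs_le: "\<bar>x\<bar> \<le> 1 + x\<^sup>2" for x :: real
    using sum_squares_bound[of 1 "\<bar>x\<bar>"] by (simp add: power2_eq_square)
  have bound1: "AE \<omega> in M. norm (T n \<omega>) \<le> 1 + J \<omega>" for n
    using bound2[of n]
  proof eventually_elim
    case (elim \<omega>)
    then show ?case using abs_le[of "T n \<omega>"] by simp
  qed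
  have J1: "integrable M (\<lambda>\<omega>. 1 + J \<omega>)"
    using J by simp
  show "integrable M (\<lambda>\<omega>. (S \<omega>)\<^sup>2)"
    by (rule integrable_dominated_convergence[OF _ _ J lim2 bound2]) auto
  show "integrable M S"
    by (rule integrable_dominated_convergence[OF _ _ J1 lim bound1]) auto
  have int: "integrable M (\<xi> k)" for k
    by (rule square_integrable_imp_integrable) (auto intro: sq)
  have int2: "integrable M (\<lambda>\<omega>. \<xi> k \<omega> * \<xi> l \<omega>)" for k l
    by (rule Bochner_Integration.integrable_bound[of _ "\<lambda>\<omega>. (\<xi> k \<omega>)\<^sup>2 + (\<xi> l \<omega>)\<^sup>2"])
       (auto intro!: sq Bochner_Integration.integrable_add AE_I2 abs_mult_le_squares)
  have "(\<lambda>n. \<integral>\<omega>. T n \<omega> \<partial>M) \<longlonglongrightarrow> (\<integral>\<omega>. S \<omega> \<partial>M)"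
    by (rule integral_dominated_convergence[OF _ _ J1 lim bound1]) auto
  moreover have "(\<integral>\<omega>. T n \<omega> \<partial>M) = 0" for n
    by (simp add: T_def int mean)
  ultimately show "(\<integral>\<omega>. S \<omega> \<partial>M) = 0"
    by (simp add: LIMSEQ_const_iff)
  have orth': "(\<integral>\<omega>. \<xi> k \<omega> * \<xi> l \<omega> \<partial>M) = 0" if "k \<noteq> l" for k l
    using orth[of l k] orth[of k l] that by (cases "l < k") (auto simp: mult.commute)
  have "(\<lambda>n. \<integral>\<omega>. (T n \<omega>)\<^sup>2 \<partial>M) \<longlonglongrightarrow> (\<integral>\<omega>. (S \<omega>)\<^sup>2 \<partial>M)"
    by (rule integral_dominated_convergence[OF _ _ J lim2 bound2]) auto
  moreover have "(\<integral>\<omega>. (T n \<omega>)\<^sup>2 \<partial>M) = (\<Sum>k<n. \<gamma> ^ (2 * (k + 1)) * (\<integral>\<omega>. (\<xi> k \<omega>)\<^sup>2 \<partial>M))" for n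
  proof -
    have "(\<integral>\<omega>. (T n \<omega>)\<^sup>2 \<partial>M) = (\<integral>\<omega>. (\<Sum>k<n. \<Sum>l<n. \<gamma> ^ (k + 1) * \<gamma> ^ (l + 1) * (\<xi> k \<omega> * \<xi> l \<omega>)) \<partial>M)"
      by (simp add: T_def power2_eq_square sum_product mult_ac)
    also have "\<dots> = (\<Sum>k<n. \<Sum>l<n. \<gamma> ^ (k + 1) * \<gamma> ^ (l + 1) * (\<integral>\<omega>. \<xi> k \<omega> * \<xi> l \<omega> \<partial>M))"
      by (simp add: int2)
    also have "\<dots> = (\<Sum>k<n. \<Sum>l<n. if l = k then \<gamma> ^ (2 * (k + 1)) * (\<integral>\<omega>. (\<xi> k \<omega>)\<^sup>2 \<partial>M) else 0)"
      by (intro sum.cong) (auto simp: orth' power2_eq_square power_add[symmetric] mult_2)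
    finally show ?thesis
      by simp
  qed
  ultimately show "(\<lambda>k. \<gamma> ^ (2 * (k + 1)) * (\<integral>\<omega>. (\<xi> k \<omega>)\<^sup>2 \<partial>M)) sums (\<integral>\<omega>. (S \<omega>)\<^sup>2 \<partial>M)"
    by (simp add: sums_def)
qed

end

section \<open>Moments of a centered Gaussian vector\<close>

text \<open>Transfers moment formulas for the normal density on the line to a random variable with
  that law.\<close>

lemma (in prob_space) normal_distr_has_integral:
  assumes [measurable]: "Y \<in> borel_measurable M" "g \<in> borel_measurable borel"
    and D: "distr M borel Y = density lborel (\<lambda>t. ennreal (normal_density \<mu> \<sigma> t))"
    and I: "has_bochner_integral lborel (\<lambda>t. normal_density \<mu> \<sigma> t * g t) (I::real)"
  shows "has_bochner_integral M (\<lambda>\<omega>. g (Y \<omega>)) I"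
proof -
  have "integrable (distr M borel Y) g" "integral\<^sup>L (distr M borel Y) g = I"
    unfolding D using I by (auto simp: integrable_density integral_density has_bochner_integral_iff)
  then show ?thesis
    by (simp add: has_bochner_integral_iff integrable_distr_eq integral_distr)
qed

text \<open>The six products are independent variables here because the identity is used twice: with
  actual products of reals for \<open>power4_polarization\<close>, and with covariances for
  Isserlis' formula.\<close>

lemma square_polarization:
  fixes q ab ac ad bc bd cd :: real
  shows "(q + 2 * (ab + ac + ad + bc + bd + cd))\<^sup>2 - (q + 2 * (ab + ac - ad + bc - bd - cd))\<^sup>2
    - (q + 2 * (ab - ac + ad - bc + bd - cd))\<^sup>2 - (q + 2 * (- ab + ac + ad - bc - bd + cd))\<^sup>2
    + (q + 2 * (ab - ac - ad - bc - bd + cd))\<^sup>2 + (q + 2 * (- ab + ac - ad - bc + bd - cd))\<^sup>2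
    + (q + 2 * (- ab - ac + ad + bc - bd - cd))\<^sup>2 - (q + 2 * (- ab - ac - ad + bc + bd + cd))\<^sup>2
    = 64 * (ab * cd + ac * bd + ad * bc)"
  by (simp add: power2_eq_square ring_distribs)

text \<open>Each fourth power is the square of an expanded square. The three pairings in
  \<open>square_polarization\<close> then coincide, whence \<open>192 = 3 * 64\<close>.\<close>

lemma power4_polarization:
  fixes a b c d :: real
  shows "(a + b + c + d) ^ 4 - (a + b + c - d) ^ 4 - (a + b - c + d) ^ 4 - (a - b + c + d) ^ 4
    + (a + b - c - d) ^ 4 + (a - b + c - d) ^ 4 + (a - b - c + d) ^ 4 - (a - b - c - d) ^ 4
    = 192 * (a * b * c * d)"
proof -
  have p: "x ^ 4 = (x\<^sup>2)\<^sup>2" for x :: real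
    by simp
  define q where "q = a\<^sup>2 + b\<^sup>2 + c\<^sup>2 + d\<^sup>2"
  have sq:
    "(a + b + c + d)\<^sup>2 = q + 2 * (a * b + a * c + a * d + b * c + b * d + c * d)"
    "(a + b + c - d)\<^sup>2 = q + 2 * (a * b + a * c - a * d + b * c - b * d - c * d)"
    "(a + b - c + d)\<^sup>2 = q + 2 * (a * b - a * c + a * d - b * c + b * d - c * d)"
    "(a - b + c + d)\<^sup>2 = q + 2 * (- (a * b) + a * c + a * d - b * c - b * d + c * d)"
    "(a + b - c - d)\<^sup>2 = q + 2 * (a * b - a * c - a * d - b * c - b * d + c * d)"
    "(a - b + c - d)\<^sup>2 = q + 2 * (- (a * b) + a * c - a * d - b * c + b * d - c * d)"
    "(a - b - c + d)\<^sup>2 = q + 2 * (- (a * b) - a * c + a * d + b * c - b * d - c * d)"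
    "(a - b - c - d)\<^sup>2 = q + 2 * (- (a * b) - a * c - a * d + b * c + b * d + c * d)"
    unfolding q_def by (simp_all add: power2_eq_square algebra_simps)
  show ?thesis
    unfolding p sq square_polarization by simp
qed

lemma power3_polarization:
  fixes a b c :: real
  shows "(a + b + c) ^ 3 - (a + b - c) ^ 3 - (a - b + c) ^ 3 + (a - b - c) ^ 3 = 24 * (a * b * c)"
  by (simp add: power3_eq_cube algebra_simps)

section \<open>Moments of linear functionals and of coordinates\<close>

locale centered_gaussian = prob_space M for M :: "'a measure" +
  fixes X :: "'a \<Rightarrow> real^'n" and S :: "real^'n^'n"
  assumes gaussian: "gaussian_vector M X"
    and mean: "(\<integral>\<omega>. X \<omega> \<partial>M) = 0"
    and covariance: "covariance_matrix M X = S"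
begin

lemma measurable_X [measurable]: "X \<in> borel_measurable M"
  using gaussian by (simp add: gaussian_vector_def)

text \<open>The normal moment formulas require a positive deviation, so the point mass is split off
  and pulled back to almost sure constancy.\<close>

lemma functional_cases:
  obtains \<mu> where "AE \<omega> in M. v \<bullet> X \<omega> = \<mu>"
  | \<mu> \<sigma> where "0 < \<sigma>" "distr M borel (\<lambda>\<omega>. v \<bullet> X \<omega>) = density lborel (\<lambda>t. ennreal (normal_density \<mu> \<sigma> t))"
proof -
  obtain \<mu> \<sigma> where *: "0 \<le> \<sigma>" "distr M borel (\<lambda>\<omega>. v \<bullet> X \<omega>) =
        (if \<sigma> = 0 then return borel \<mu> else density lborel (\<lambda>t. ennreal (normal_density \<mu> \<sigma> t)))"
    using gaussian unfolding gaussian_vector_def by blast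
  show ?thesis
  proof (cases "\<sigma> = 0")
    case True
    then have "distr M borel (\<lambda>\<omega>. v \<bullet> X \<omega>) = return borel \<mu>"
      using * by simp
    then have "AE y in distr M borel (\<lambda>\<omega>. v \<bullet> X \<omega>). y = \<mu>"
      by (simp only: AE_return) (subst AE_return; simp)
    then have "AE \<omega> in M. v \<bullet> X \<omega> = \<mu>"
      by (subst (asm) AE_distr_iff) auto
    then show ?thesis by (rule that)
  next
    case False
    then show ?thesis using that(2)[of \<sigma> \<mu>] * by simp
  qed
qed

lemma integrable_functional: "integrable M (\<lambda>\<omega>. v \<bullet> X \<omega>)"
proof (cases rule: functional_cases[of v])
  case (1 \<mu>)
  then show ?thesis
    by (subst integrable_cong_AE[where g = "\<lambda>_. \<mu>"]) auto
next
  case (2 \<mu> \<sigma>)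
  have "has_bochner_integral M (\<lambda>\<omega>. v \<bullet> X \<omega>) \<mu>"
    by (rule normal_distr_has_integral[OF _ _ 2(2) normal_moment_nz_1[OF 2(1)]]) simp_all
  then show ?thesis
    by (simp add: has_bochner_integral_iff)
qed

text \<open>Lets the inner product be exchanged with the integral. The equation \<open>mean\<close>
  alone does not give integrability, as the integral of a non-integrable function is 0 by
  convention.\<close>

lemma integrable_X: "integrable M X"
proof -
  have "integrable M (\<lambda>\<omega>. \<Sum>b\<in>Basis. (b \<bullet> X \<omega>) *\<^sub>R b)"
    by (intro Bochner_Integration.integrable_sum integrable_scaleR_left integrable_functional)
  then show ?thesis
    by (simp add: inner_commute[of _ "X _"] euclidean_representation)
qed

lemma has_integral_functional: "has_bochner_integral M (\<lambda>\<omega>. v \<bullet> X \<omega>) 0"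
  using integrable_functional integrable_X by (simp add: has_bochner_integral_iff mean)

text \<open>The variance stays an unknown \<open>s\<close> at this point: identifying it with
  \<open>v \<bullet> (S *v v)\<close> needs integrable products of coordinates, which are themselves
  derived from this lemma.\<close>

lemma functional_moments_ex:
  "\<exists>s. has_bochner_integral M (\<lambda>\<omega>. (v \<bullet> X \<omega>)\<^sup>2) s \<and> has_bochner_integral M (\<lambda>\<omega>. (v \<bullet> X \<omega>) ^ 3) 0
     \<and> has_bochner_integral M (\<lambda>\<omega>. (v \<bullet> X \<omega>) ^ 4) (3 * s\<^sup>2)"
proof (cases rule: functional_cases[of v])
  case (1 \<mu>)
  then have "(\<integral>\<omega>. v \<bullet> X \<omega> \<partial>M) = (\<integral>\<omega>. \<mu> \<partial>M)"
    by (intro integral_cong_AE) auto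
  then have "\<mu> = 0"
    using has_integral_functional[of v] by (simp add: has_bochner_integral_iff prob_space)
  with 1 have ae: "AE \<omega> in M. v \<bullet> X \<omega> = 0"
    by simp
  have "has_bochner_integral M (\<lambda>\<omega>. (v \<bullet> X \<omega>) ^ n) 0" if "n > 0" for n
    by (subst has_bochner_integral_cong_AE[where g = "\<lambda>_. 0"])
       (use ae that in \<open>auto simp: has_bochner_integral_zero elim!: eventually_mono\<close>)
  then show ?thesis
    by (intro exI[of _ 0]) auto
next
  case (2 \<mu> \<sigma>)
  have "has_bochner_integral M (\<lambda>\<omega>. v \<bullet> X \<omega>) \<mu>"
    by (rule normal_distr_has_integral[OF _ _ 2(2) normal_moment_nz_1[OF 2(1)]]) simp_all
  then have \<mu>: "\<mu> = 0"
    by (rule has_bochner_integral_eq) (rule has_integral_functional)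
  have even: "has_bochner_integral M (\<lambda>\<omega>. (v \<bullet> X \<omega>) ^ (2 * k)) (fact (2 * k) / ((2 / \<sigma>\<^sup>2) ^ k * fact k))" for k
    by (rule normal_distr_has_integral[OF _ _ 2(2)[unfolded \<mu>] normal_moment_even[OF 2(1), of 0 k, unfolded diff_zero]]) simp_all
  have odd: "has_bochner_integral M (\<lambda>\<omega>. (v \<bullet> X \<omega>) ^ (2 * k + 1)) 0" for k
    by (rule normal_distr_has_integral[OF _ _ 2(2)[unfolded \<mu>] normal_moment_odd[OF 2(1), of 0 k, unfolded diff_zero]]) simp_all
  have "has_bochner_integral M (\<lambda>\<omega>. (v \<bullet> X \<omega>)\<^sup>2) (\<sigma>\<^sup>2)"
    using even[of 1] by simp
  moreover have "has_bochner_integral M (\<lambda>\<omega>. (v \<bullet> X \<omega>) ^ 3) 0"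
    using odd[of 1] by simp
  moreover have "fact (2 * 2) / ((2 / \<sigma>\<^sup>2) ^ 2 * fact 2) = 3 * (\<sigma>\<^sup>2)\<^sup>2"
    by (simp add: fact_numeral power_divide)
  then have "has_bochner_integral M (\<lambda>\<omega>. (v \<bullet> X \<omega>) ^ 4) (3 * (\<sigma>\<^sup>2)\<^sup>2)"
    using even[of 2] by (simp only: mult_2 numeral_Bit0[symmetric] flip: numeral_Bit0)
  ultimately show ?thesis
    by blast
qed

lemma integrable_functional_power2: "integrable M (\<lambda>\<omega>. (v \<bullet> X \<omega>)\<^sup>2)"
  using functional_moments_ex[of v] by (auto simp: has_bochner_integral_iff)

lemma nth_eq_functional: "X \<omega> $ i = axis i 1 \<bullet> X \<omega>"
  by (simp add: inner_axis')

lemma has_integral_nth: "has_bochner_integral M (\<lambda>\<omega>. X \<omega> $ i) 0"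
  unfolding nth_eq_functional by (rule has_integral_functional)

lemma has_integral_nth2: "has_bochner_integral M (\<lambda>\<omega>. X \<omega> $ i * X \<omega> $ j) (S $ i $ j)"
proof -
  have "integrable M (\<lambda>\<omega>. X \<omega> $ i * X \<omega> $ j)"
    unfolding nth_eq_functional
    by (rule Bochner_Integration.integrable_bound[of _ "\<lambda>\<omega>. (axis i 1 \<bullet> X \<omega>)\<^sup>2 + (axis j 1 \<bullet> X \<omega>)\<^sup>2"])
       (auto intro!: integrable_functional_power2 AE_I2 abs_mult_le_squares)
  then show ?thesis
    by (simp add: has_bochner_integral_iff covariance_matrix_def mean flip: covariance)
qed

lemma covariance_symmetric: "S $ i $ j = S $ j $ i"
  by (simp add: covariance_matrix_def mult.commute flip: covariance)

lemma has_integral_functional_power2: "has_bochner_integral M (\<lambda>\<omega>. (v \<bullet> X \<omega>)\<^sup>2) (v \<bullet> (S *v v))"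
proof -
  have "has_bochner_integral M (\<lambda>\<omega>. \<Sum>i\<in>UNIV. \<Sum>j\<in>UNIV. v $ i * v $ j * (X \<omega> $ i * X \<omega> $ j))
    (\<Sum>i\<in>UNIV. \<Sum>j\<in>UNIV. v $ i * v $ j * S $ i $ j)"
    by (intro has_bochner_integral_sum has_bochner_integral_mult_right has_integral_nth2)
  then show ?thesis
    by (simp add: inner_vec_def matrix_vector_mult_def power2_eq_square sum_product sum_distrib_left mult_ac)
qed

lemma has_integral_functional_power3: "has_bochner_integral M (\<lambda>\<omega>. (v \<bullet> X \<omega>) ^ 3) 0"
  using functional_moments_ex[of v] by auto

lemma has_integral_functional_power4:
  "has_bochner_integral M (\<lambda>\<omega>. (v \<bullet> X \<omega>) ^ 4) (3 * (v \<bullet> (S *v v))\<^sup>2)"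
proof -
  obtain s where s: "has_bochner_integral M (\<lambda>\<omega>. (v \<bullet> X \<omega>)\<^sup>2) s"
    "has_bochner_integral M (\<lambda>\<omega>. (v \<bullet> X \<omega>) ^ 4) (3 * s\<^sup>2)"
    using functional_moments_ex[of v] by auto
  have "s = v \<bullet> (S *v v)"
    by (rule has_bochner_integral_eq[OF s(1) has_integral_functional_power2])
  with s(2) show ?thesis
    by simp
qed

text \<open>The third moments along the four directions
  \<open>e i \<plusminus> e j \<plusminus> e k\<close> vanish, and polarization recovers the mixed
  moment.\<close>

lemma has_integral_nth3: "has_bochner_integral M (\<lambda>\<omega>. X \<omega> $ i * X \<omega> $ j * X \<omega> $ k) 0"
proof -
  define e :: "'n \<Rightarrow> real^'n" where "e = (\<lambda>i. axis i 1)"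
  define H where "H = (\<lambda>v \<omega>. (v \<bullet> X \<omega>) ^ 3 :: real)"
  have "has_bochner_integral M (\<lambda>\<omega>. 1 / 24 * (H (e i + e j + e k) \<omega> - H (e i + e j - e k) \<omega>
      - H (e i - e j + e k) \<omega> + H (e i - e j - e k) \<omega>)) (1 / 24 * (0 - 0 - 0 + 0))"
    unfolding H_def
    by (intro has_bochner_integral_mult_right has_bochner_integral_add has_bochner_integral_diff
        has_integral_functional_power3)
  then show ?thesis
    unfolding H_def inner_diff_left inner_add_left power3_polarization e_def
    by (simp add: nth_eq_functional)
qed

text \<open>Isserlis' formula. Along the eight directions
  \<open>e i \<plusminus> e j \<plusminus> e k \<plusminus> e l\<close> the fourth moment is three
  times the squared variance; polarizing both sides leaves the three pairings.\<close>

lemma has_integral_nth4: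
  "has_bochner_integral M (\<lambda>\<omega>. X \<omega> $ i * X \<omega> $ j * X \<omega> $ k * X \<omega> $ l)
     (S $ i $ j * S $ k $ l + S $ i $ k * S $ j $ l + S $ i $ l * S $ j $ k)"
proof -
  define e :: "'n \<Rightarrow> real^'n" where "e = (\<lambda>i. axis i 1)"
  define q where "q = (\<lambda>v. v \<bullet> (S *v v))"
  define b where "b = (\<lambda>u v. u \<bullet> (S *v v))"
  have b: "b (e i) (e j) = S $ i $ j" for i j
    by (simp add: b_def e_def inner_axis' matrix_vector_mul_component inner_axis)
  have b_add: "b (u + v) w = b u w + b v w" "b w (u + v) = b w u + b w v"
    "b (u - v) w = b u w - b v w" "b w (u - v) = b w u - b w v" for u v w
    by (simp_all add: b_def inner_add_left inner_add_right inner_diff_left inner_diff_right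
        matrix_vector_right_distrib matrix_vector_mult_diff_distrib)
  have qb: "q v = b v v" for v
    by (simp add: q_def b_def)
  \<comment> \<open>The diagonal part common to all eight variances; it takes the place of
    \<open>q\<close> in \<open>square_polarization\<close>.\<close>
  define d where "d = S $ i $ i + S $ j $ j + S $ k $ k + S $ l $ l"
  note q_expand = qb b_add b d_def covariance_symmetric[of j i] covariance_symmetric[of k i] covariance_symmetric[of l i]
    covariance_symmetric[of k j] covariance_symmetric[of l j] covariance_symmetric[of l k]
  have q:
    "q (e i + e j + e k + e l) = d + 2 * (S$i$j + S$i$k + S$i$l + S$j$k + S$j$l + S$k$l)"
    "q (e i + e j + e k - e l) = d + 2 * (S$i$j + S$i$k - S$i$l + S$j$k - S$j$l - S$k$l)"
    "q (e i + e j - e k + e l) = d + 2 * (S$i$j - S$i$k + S$i$l - S$j$k + S$j$l - S$k$l)"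
    "q (e i - e j + e k + e l) = d + 2 * (- S$i$j + S$i$k + S$i$l - S$j$k - S$j$l + S$k$l)"
    "q (e i + e j - e k - e l) = d + 2 * (S$i$j - S$i$k - S$i$l - S$j$k - S$j$l + S$k$l)"
    "q (e i - e j + e k - e l) = d + 2 * (- S$i$j + S$i$k - S$i$l - S$j$k + S$j$l - S$k$l)"
    "q (e i - e j - e k + e l) = d + 2 * (- S$i$j - S$i$k + S$i$l + S$j$k - S$j$l - S$k$l)"
    "q (e i - e j - e k - e l) = d + 2 * (- S$i$j - S$i$k - S$i$l + S$j$k + S$j$l + S$k$l)"
    unfolding q_expand by simp_all
  define H where "H = (\<lambda>v \<omega>. (v \<bullet> X \<omega>) ^ 4 :: real)"
  have H: "has_bochner_integral M (H v) (3 * (q v)\<^sup>2)" for v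
    unfolding H_def q_def by (rule has_integral_functional_power4)
  \<comment> \<open>On the right, the 3 of the fourth moment and the 64 of
    \<open>square_polarization\<close> multiply to 192, the constant of
    \<open>power4_polarization\<close> on the left.\<close>
  have "has_bochner_integral M (\<lambda>\<omega>. 1 / 192 * (H (e i + e j + e k + e l) \<omega> - H (e i + e j + e k - e l) \<omega>
      - H (e i + e j - e k + e l) \<omega> - H (e i - e j + e k + e l) \<omega> + H (e i + e j - e k - e l) \<omega>
      + H (e i - e j + e k - e l) \<omega> + H (e i - e j - e k + e l) \<omega> - H (e i - e j - e k - e l) \<omega>))
     (1 / 192 * (3 * (q (e i + e j + e k + e l))\<^sup>2 - 3 * (q (e i + e j + e k - e l))\<^sup>2
      - 3 * (q (e i + e j - e k + e l))\<^sup>2 - 3 * (q (e i - e j + e k + e l))\<^sup>2 + 3 * (q (e i + e j - e k - e l))\<^sup>2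
      + 3 * (q (e i - e j + e k - e l))\<^sup>2 + 3 * (q (e i - e j - e k + e l))\<^sup>2 - 3 * (q (e i - e j - e k - e l))\<^sup>2))"
    by (intro has_bochner_integral_mult_right has_bochner_integral_add has_bochner_integral_diff H)
  then show ?thesis
    unfolding q right_diff_distrib[symmetric] distrib_left[symmetric] square_polarization
    unfolding H_def inner_diff_left inner_add_left power4_polarization e_def
    by (simp add: nth_eq_functional add_divide_distrib)
qed

end

section \<open>The noise-driven state\<close>

text \<open>For the trajectory \<open>x\<^sub>0 = x\<close>, \<open>x\<^sub>k\<^sub>+\<^sub>1 = F x\<^sub>k + u\<^sub>k\<close> this is \<open>F x\<^sub>k\<close>, which depends on
  \<open>u\<^sub>0, \<dots>, u\<^sub>k\<^sub>-\<^sub>1\<close> only.\<close>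

primrec state :: "real^'n^'n \<Rightarrow> real^'n \<Rightarrow> (nat \<Rightarrow> real^'n) \<Rightarrow> nat \<Rightarrow> real^'n" where
  "state F x u 0 = F *v x"
| "state F x u (Suc k) = F *v (state F x u k + u k)"

text \<open>The matrix of second moments \<open>E (y y\<^sup>T)\<close> of \<open>state\<close>
  under independent centered noise of covariance \<open>S\<close>, as
  \<open>has_integral_state_state\<close> shows.\<close>

primrec state_moment :: "real^'n^'n \<Rightarrow> real^'n \<Rightarrow> real^'n^'n \<Rightarrow> nat \<Rightarrow> real^'n^'n" where
  "state_moment F x S 0 = F ** outer_product x x ** transpose F"
| "state_moment F x S (Suc k) = F ** (state_moment F x S k + S) ** transpose F"

text \<open>Separates the part driven by \<open>x\<close>, which occurs in
  \<open>return_term1\<close>, from the part driven by the noise, which occurs in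
  \<open>return_term3\<close>.\<close>

lemma state_eq:
  "state F x u k = matpow F (k + 1) *v x + (\<Sum>\<tau><k. matpow F (k - \<tau>) *v u \<tau>)"
proof (induction k)
  case 0
  show ?case by (simp add: matpow_Suc)
next
  case (Suc k)
  have "F *v (\<Sum>\<tau><k. matpow F (k - \<tau>) *v u \<tau>) = (\<Sum>\<tau><k. matpow F (Suc k - \<tau>) *v u \<tau>)"
    unfolding linear_sum[OF matrix_vector_mul_linear]
    by (intro sum.cong refl) (simp add: Suc_diff_le matpow_Suc matrix_vector_mul_assoc)
  moreover have "F *v (matpow F (k + 1) *v x) = matpow F (Suc k + 1) *v x"
    by (simp add: matpow_Suc matrix_vector_mul_assoc)
  moreover have "matpow F (Suc k - k) = F"
    by (simp add: matpow_Suc)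
  ultimately show ?case
    by (simp only: Suc state.simps matrix_vector_right_distrib sum.lessThan_Suc add.assoc)
qed

text \<open>The Frobenius pairing; it collapses the double sums produced by moments of
  coordinates.\<close>

lemma sum_mult_eq_trace:
  fixes X Y :: "real^'n^'n"
  assumes "transpose X = X"
  shows "(\<Sum>i\<in>UNIV. \<Sum>j\<in>UNIV. X $ i $ j * Y $ i $ j) = trace (X ** Y)"
proof -
  have "X $ i $ j = X $ j $ i" for i j
    using arg_cong[OF assms, of "\<lambda>Z. Z $ j $ i"] by (simp add: transpose_def)
  then have "(\<Sum>i\<in>UNIV. \<Sum>j\<in>UNIV. X $ i $ j * Y $ i $ j) = (\<Sum>i\<in>UNIV. \<Sum>j\<in>UNIV. X $ j $ i * Y $ i $ j)"
    by simp
  also have "\<dots> = trace (X ** Y)"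
    by (subst sum.swap) (simp add: trace_def matrix_matrix_mult_def)
  finally show ?thesis .
qed

lemma borel_measurable_nth: "(\<lambda>v :: real^'n. v $ i) \<in> borel_measurable borel"
  by (intro borel_measurable_continuous_onI continuous_on_component continuous_on_id)

section \<open>Independent Gaussian noise and the random variables determined by its past\<close>

locale gaussian_noise = prob_space M for M :: "'a measure" +
  fixes w :: "nat \<Rightarrow> 'a \<Rightarrow> real^'n" and S :: "real^'n^'n"
  assumes indep: "indep_vars (\<lambda>_. borel) w UNIV"
    and gaussian: "\<And>k. centered_gaussian M (w k) S"
begin

lemma measurable_w [measurable]: "w k \<in> borel_measurable M"
  by (rule centered_gaussian.measurable_X[OF gaussian])

lemmas has_integral_w = centered_gaussian.has_integral_nth[OF gaussian]
  and has_integral_w2 = centered_gaussian.has_integral_nth2[OF gaussian]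
  and has_integral_w3 = centered_gaussian.has_integral_nth3[OF gaussian]
  and has_integral_w4 = centered_gaussian.has_integral_nth4[OF gaussian]
  and covariance_symmetric = centered_gaussian.covariance_symmetric[OF gaussian]

lemma transpose_S: "transpose S = S"
  using covariance_symmetric by (simp add: transpose_def vec_eq_iff)

text \<open>Stated as a factorization through the tuple of the first \<open>k\<close> noise vectors
  instead of measurability for a sub-sigma-algebra, since independence of disjoint blocks of
  \<open>w\<close> applies to such tuples directly.\<close>

definition adapted :: "nat \<Rightarrow> ('a \<Rightarrow> real) \<Rightarrow> bool" where
  "adapted k U \<longleftrightarrow> (\<exists>g \<in> borel_measurable (PiM {..<k} (\<lambda>_. borel)). \<forall>\<omega>. U \<omega> = g (restrict (\<lambda>i. w i \<omega>) {..<k}))"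

lemma adaptedI:
  assumes "g \<in> borel_measurable (PiM {..<k} (\<lambda>_. borel))" "\<And>\<omega>. U \<omega> = g (restrict (\<lambda>i. w i \<omega>) {..<k})"
  shows "adapted k U"
  using assms by (auto simp: adapted_def)

lemma adaptedE:
  assumes "adapted k U"
  obtains g where "g \<in> borel_measurable (PiM {..<k} (\<lambda>_. borel))" "U = (\<lambda>\<omega>. g (restrict (\<lambda>i. w i \<omega>) {..<k}))"
  using assms by (auto simp: adapted_def fun_eq_iff)

lemma adapted_const: "adapted k (\<lambda>_. c)"
  by (rule adaptedI[of "\<lambda>_. c"]) simp_all

lemma adapted_add:
  assumes "adapted k U" "adapted k V" shows "adapted k (\<lambda>\<omega>. U \<omega> + V \<omega>)"
proof -
  obtain g where "g \<in> borel_measurable (PiM {..<k} (\<lambda>_. borel))" "U = (\<lambda>\<omega>. g (restrict (\<lambda>i. w i \<omega>) {..<k}))"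
    using assms(1) by (rule adaptedE)
  moreover obtain h where "h \<in> borel_measurable (PiM {..<k} (\<lambda>_. borel))" "V = (\<lambda>\<omega>. h (restrict (\<lambda>i. w i \<omega>) {..<k}))"
    using assms(2) by (rule adaptedE)
  ultimately show ?thesis
    by (intro adaptedI[of "\<lambda>u. g u + h u"] borel_measurable_add) simp_all
qed

lemma adapted_mult:
  assumes "adapted k U" "adapted k V" shows "adapted k (\<lambda>\<omega>. U \<omega> * V \<omega>)"
proof -
  obtain g where "g \<in> borel_measurable (PiM {..<k} (\<lambda>_. borel))" "U = (\<lambda>\<omega>. g (restrict (\<lambda>i. w i \<omega>) {..<k}))"
    using assms(1) by (rule adaptedE)
  moreover obtain h where "h \<in> borel_measurable (PiM {..<k} (\<lambda>_. borel))" "V = (\<lambda>\<omega>. h (restrict (\<lambda>i. w i \<omega>) {..<k}))"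
    using assms(2) by (rule adaptedE)
  ultimately show ?thesis
    by (intro adaptedI[of "\<lambda>u. g u * h u"] borel_measurable_times) simp_all
qed

lemma adapted_sum:
  assumes "\<And>i. i \<in> I \<Longrightarrow> adapted k (U i)"
  shows "adapted k (\<lambda>\<omega>. \<Sum>i\<in>I. U i \<omega>)"
  using assms
  by (induction I rule: infinite_finite_induct) (auto intro: adapted_const adapted_add)

lemma adapted_w:
  assumes "l < k"
  shows "adapted k (\<lambda>\<omega>. w l \<omega> $ i)"
proof (rule adaptedI)
  have "(\<lambda>u. u l) \<in> measurable (PiM {..<k} (\<lambda>_. borel)) (borel :: (real^'n) measure)"
    using measurable_component_singleton[of l "{..<k}" "\<lambda>_. borel"] assms by simp
  then show "(\<lambda>u. u l $ i) \<in> borel_measurable (PiM {..<k} (\<lambda>_. borel :: (real^'n) measure))"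
    by (rule measurable_compose) (rule borel_measurable_nth)
  show "w l \<omega> $ i = restrict (\<lambda>i. w i \<omega>) {..<k} l $ i" for \<omega>
    using assms by simp
qed

lemma adapted_mono:
  assumes "adapted k U" "k \<le> l"
  shows "adapted l U"
proof -
  obtain g where g: "g \<in> borel_measurable (PiM {..<k} (\<lambda>_. borel))" "U = (\<lambda>\<omega>. g (restrict (\<lambda>i. w i \<omega>) {..<k}))"
    using assms(1) by (rule adaptedE)
  show ?thesis
  proof (rule adaptedI[of "\<lambda>u. g (restrict u {..<k})"])
    show "(\<lambda>u. g (restrict u {..<k})) \<in> borel_measurable (PiM {..<l} (\<lambda>_. borel))"
      using assms(2) by (intro measurable_compose[OF measurable_restrict_subset g(1)]) auto
    have "{..<l} \<inter> {..<k} = {..<k}"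
      using assms(2) by auto
    then show "U \<omega> = g (restrict (restrict (\<lambda>i. w i \<omega>) {..<l}) {..<k})" for \<omega>
      by (simp add: g(2) restrict_restrict)
  qed
qed

lemma measurable_adapted [measurable_dest]:
  assumes "adapted k U"
  shows "U \<in> borel_measurable M"
proof -
  obtain g where g: "g \<in> borel_measurable (PiM {..<k} (\<lambda>_. borel))" "U = (\<lambda>\<omega>. g (restrict (\<lambda>i. w i \<omega>) {..<k}))"
    using assms by (rule adaptedE)
  show ?thesis
    unfolding g(2) by (rule measurable_compose[OF _ g(1)]) (auto intro: measurable_restrict)
qed

text \<open>The index sets \<open>{k}\<close> and \<open>{..<k}\<close> are disjoint, so
  \<open>w k\<close> is independent of everything determined by the earlier noise.\<close>

lemma has_integral_indep_mult:
  assumes [measurable]: "f \<in> borel_measurable borel" and U: "adapted k U"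
    and fI: "has_bochner_integral M (\<lambda>\<omega>. f (w k \<omega>)) a" and UI: "has_bochner_integral M U (b::real)"
  shows "has_bochner_integral M (\<lambda>\<omega>. f (w k \<omega>) * U \<omega>) (a * b)"
proof -
  obtain g where g: "g \<in> borel_measurable (PiM {..<k} (\<lambda>_. borel))" "U = (\<lambda>\<omega>. g (restrict (\<lambda>i. w i \<omega>) {..<k}))"
    using U by (rule adaptedE)
  have "indep_var (PiM {k} (\<lambda>_. borel)) (\<lambda>\<omega>. restrict (\<lambda>i. w i \<omega>) {k}) (PiM {..<k} (\<lambda>_. borel)) (\<lambda>\<omega>. restrict (\<lambda>i. w i \<omega>) {..<k})"
    by (rule indep_var_restrict[OF indep]) auto
  then have "indep_var borel ((\<lambda>u. f (u k)) \<circ> (\<lambda>\<omega>. restrict (\<lambda>i. w i \<omega>) {k})) borel (g \<circ> (\<lambda>\<omega>. restrict (\<lambda>i. w i \<omega>) {..<k}))"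
    by (rule indep_var_compose) (use g in measurable)
  then have "indep_var borel (\<lambda>\<omega>. f (w k \<omega>)) borel U"
    by (simp add: g(2) comp_def)
  with fI UI show ?thesis
    by (simp add: has_bochner_integral_iff indep_var_integrable indep_var_lebesgue_integral)
qed

lemma adapted_matrix_vector_mult:
  assumes "\<And>i. adapted k (\<lambda>\<omega>. Y \<omega> $ i)"
  shows "adapted k (\<lambda>\<omega>. (N *v Y \<omega>) $ i)"
  unfolding matrix_vector_mult_def vec_lambda_beta
  by (intro adapted_sum adapted_mult adapted_const assms)

lemma adapted_state: "adapted k (\<lambda>\<omega>. state F x (\<lambda>j. w j \<omega>) k $ i)"
proof (induction k arbitrary: i)
  case 0
  show ?case by (simp add: adapted_const)
next
  case (Suc k)
  have "adapted (Suc k) (\<lambda>\<omega>. state F x (\<lambda>j. w j \<omega>) k $ i)" for i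
    using Suc by (rule adapted_mono) simp
  then have "adapted (Suc k) (\<lambda>\<omega>. (state F x (\<lambda>j. w j \<omega>) k + w k \<omega>) $ i)" for i
    unfolding vector_add_component by (intro adapted_add adapted_w) simp_all
  then show ?case
    unfolding state.simps by (rule adapted_matrix_vector_mult)
qed

text \<open>Induction along the recursion: the state is determined by the noise before
  \<open>w k\<close>, so its products with the centered \<open>w k\<close> have mean 0 and only the
  moments of the state and \<open>S\<close> remain.\<close>

lemma has_integral_state_state:
  "has_bochner_integral M (\<lambda>\<omega>. state F x (\<lambda>j. w j \<omega>) k $ i * state F x (\<lambda>j. w j \<omega>) k $ j) (state_moment F x S k $ i $ j)"
proof (induction k arbitrary: i j)
  case 0
  have "state F x (\<lambda>j. w j \<omega>) 0 $ i * state F x (\<lambda>j. w j \<omega>) 0 $ j = state_moment F x S 0 $ i $ j" for \<omega>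
    unfolding state.simps state_moment.simps congruence_nth
    by (simp add: outer_product_def matrix_vector_mult_def sum_product mult_ac)
  then show ?case
    by (simp add: has_bochner_integral_iff prob_space)
next
  case (Suc k)
  define y where "y = (\<lambda>\<omega>. state F x (\<lambda>j. w j \<omega>) k)"
  define V where "V = state_moment F x S k"
  have IH: "has_bochner_integral M (\<lambda>\<omega>. y \<omega> $ a * y \<omega> $ b) (V $ a $ b)" for a b
    unfolding y_def V_def by (rule Suc.IH)
  have y: "adapted k (\<lambda>\<omega>. y \<omega> $ a)" for a
    unfolding y_def by (rule adapted_state)
  have "integrable M (\<lambda>\<omega>. y \<omega> $ a)" for a
    by (rule square_integrable_imp_integrable[OF measurable_adapted[OF y]])
       (use IH[of a a] in \<open>simp add: has_bochner_integral_iff power2_eq_square\<close>)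
  \<comment> \<open>The value of this mean is never computed: it is multiplied by the zero mean of
    \<open>w k\<close>.\<close>
  then have yI: "has_bochner_integral M (\<lambda>\<omega>. y \<omega> $ a) (\<integral>\<omega>. y \<omega> $ a \<partial>M)" for a
    by (simp add: has_bochner_integral_iff)
  have cross: "has_bochner_integral M (\<lambda>\<omega>. w k \<omega> $ a * y \<omega> $ b) 0" for a b
    using has_integral_indep_mult[OF borel_measurable_nth y has_integral_w yI, of a b]
    unfolding mult_zero_left .
  have "has_bochner_integral M (\<lambda>\<omega>. \<Sum>a\<in>UNIV. \<Sum>b\<in>UNIV. F $ i $ a * F $ j $ b *
      (y \<omega> $ a * y \<omega> $ b + w k \<omega> $ a * y \<omega> $ b + w k \<omega> $ b * y \<omega> $ a + w k \<omega> $ a * w k \<omega> $ b))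
     (\<Sum>a\<in>UNIV. \<Sum>b\<in>UNIV. F $ i $ a * F $ j $ b * (V $ a $ b + 0 + 0 + S $ a $ b))"
    by (intro has_bochner_integral_sum has_bochner_integral_mult_right has_bochner_integral_add cross
        has_integral_w2 IH)
  moreover have "(\<Sum>a\<in>UNIV. \<Sum>b\<in>UNIV. F $ i $ a * F $ j $ b * (V $ a $ b + 0 + 0 + S $ a $ b))
    = state_moment F x S (Suc k) $ i $ j"
    unfolding state_moment.simps congruence_nth V_def[symmetric] by simp
  moreover have "(\<Sum>a\<in>UNIV. \<Sum>b\<in>UNIV. F $ i $ a * F $ j $ b *
      (y \<omega> $ a * y \<omega> $ b + w k \<omega> $ a * y \<omega> $ b + w k \<omega> $ b * y \<omega> $ a + w k \<omega> $ a * w k \<omega> $ b))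
    = state F x (\<lambda>j. w j \<omega>) (Suc k) $ i * state F x (\<lambda>j. w j \<omega>) (Suc k) $ j" for \<omega>
    unfolding state.simps y_def[symmetric] matrix_vector_mult_def vec_lambda_beta sum_product
    by (intro sum.cong refl) (simp add: y_def algebra_simps)
  ultimately show ?case
    by simp
qed

section \<open>Moments of the quadratic and the linear terms in the noise\<close>

context
  fixes P F :: "real^'n^'n" and x :: "real^'n"
  assumes P: "transpose P = P"
begin

lemma P_sym: "P $ i $ j = P $ j $ i"
  using arg_cong[OF P, of "\<lambda>Z. Z $ j $ i"] by (simp add: transpose_def)

abbreviation costate :: "nat \<Rightarrow> 'a \<Rightarrow> real^'n" where
  "costate k \<omega> \<equiv> P *v state F x (\<lambda>j. w j \<omega>) k"

abbreviation costate_moment :: "nat \<Rightarrow> real^'n^'n" where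
  "costate_moment k \<equiv> P ** state_moment F x S k ** transpose P"

lemma quadratic_form_eq: "v \<bullet> (P *v v) = (\<Sum>i\<in>UNIV. \<Sum>j\<in>UNIV. P $ i $ j * (v $ i * v $ j))"
  by (simp add: inner_vec_def matrix_vector_mult_def sum_distrib_left mult_ac)

lemma adapted_costate: "adapted k (\<lambda>\<omega>. costate k \<omega> $ i)"
  by (intro adapted_matrix_vector_mult adapted_state)

lemma has_integral_costate2:
  "has_bochner_integral M (\<lambda>\<omega>. costate k \<omega> $ i * costate k \<omega> $ j) (costate_moment k $ i $ j)"
proof -
  have eq: "(P *v y) $ i * (P *v y) $ j = (\<Sum>a\<in>UNIV. \<Sum>b\<in>UNIV. P $ i $ a * P $ j $ b * (y $ a * y $ b))" for y
    by (simp add: matrix_vector_mult_def sum_product mult_ac)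
  have "has_bochner_integral M (\<lambda>\<omega>. \<Sum>a\<in>UNIV. \<Sum>b\<in>UNIV. P $ i $ a * P $ j $ b *
      (state F x (\<lambda>j. w j \<omega>) k $ a * state F x (\<lambda>j. w j \<omega>) k $ b))
     (\<Sum>a\<in>UNIV. \<Sum>b\<in>UNIV. P $ i $ a * P $ j $ b * state_moment F x S k $ a $ b)"
    by (intro has_bochner_integral_sum has_bochner_integral_mult_right has_integral_state_state)
  then show ?thesis
    unfolding congruence_nth[symmetric] by (simp add: eq)
qed

lemma has_integral_costate:
  "has_bochner_integral M (\<lambda>\<omega>. costate k \<omega> $ i) (\<integral>\<omega>. costate k \<omega> $ i \<partial>M)"
  using square_integrable_imp_integrable[OF measurable_adapted[OF adapted_costate], of k i]
    integrable.intros[OF has_integral_costate2[of k i i]]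
  by (simp only: has_bochner_integral_iff power2_eq_square simp_thms)

lemma has_integral_quadratic: "has_bochner_integral M (\<lambda>\<omega>. w k \<omega> \<bullet> (P *v w k \<omega>)) (trace (P ** S))"
  unfolding quadratic_form_eq sum_mult_eq_trace[OF P, symmetric]
  by (intro has_bochner_integral_sum has_bochner_integral_mult_right has_integral_w2)

text \<open>Of the three pairings in Isserlis' formula, the first gives the squared trace and each
  of the other two gives \<open>trace (P ** S ** P ** S)\<close>.\<close>

lemma has_integral_quadratic_power2:
  "has_bochner_integral M (\<lambda>\<omega>. (w k \<omega> \<bullet> (P *v w k \<omega>))\<^sup>2)
     ((trace (P ** S))\<^sup>2 + 2 * trace (P ** S ** P ** S))"
proof -
  let ?U = "UNIV :: 'n set"
  have "has_bochner_integral M (\<lambda>\<omega>. \<Sum>i\<in>?U. \<Sum>j\<in>?U. \<Sum>k'\<in>?U. \<Sum>l\<in>?U. P $ i $ j * P $ k' $ l *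
      (w k \<omega> $ i * w k \<omega> $ j * w k \<omega> $ k' * w k \<omega> $ l))
    (\<Sum>i\<in>?U. \<Sum>j\<in>?U. \<Sum>k'\<in>?U. \<Sum>l\<in>?U. P $ i $ j * P $ k' $ l *
      (S $ i $ j * S $ k' $ l + S $ i $ k' * S $ j $ l + S $ i $ l * S $ j $ k'))" (is "has_bochner_integral M ?L ?R")
    by (intro has_bochner_integral_sum has_bochner_integral_mult_right has_integral_w4)
  moreover have "?L = (\<lambda>\<omega>. (w k \<omega> \<bullet> (P *v w k \<omega>))\<^sup>2)"
    unfolding quadratic_form_eq power2_eq_square sum_distrib_right
    unfolding sum_distrib_left by (simp add: mult_ac)
  moreover have "?R = (trace (P ** S))\<^sup>2 + 2 * trace (P ** S ** P ** S)"
  proof -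
    have SPS: "(S ** P ** transpose S) $ i $ j = (\<Sum>k'\<in>?U. \<Sum>l\<in>?U. S $ i $ k' * S $ j $ l * P $ k' $ l)" for i j
      by (rule congruence_nth)
    \<comment> \<open>The third pairing becomes the second by exchanging the two inner indices,
      which the symmetry of \<open>P\<close> allows.\<close>
    have SPS': "(S ** P ** transpose S) $ i $ j = (\<Sum>k'\<in>?U. \<Sum>l\<in>?U. S $ i $ l * S $ j $ k' * P $ k' $ l)" for i j
      unfolding SPS by (subst sum.swap) (intro sum.cong refl arg_cong2[where f = "(*)"] P_sym)
    have tr: "trace (P ** S ** P ** S) = (\<Sum>i\<in>?U. \<Sum>j\<in>?U. P $ i $ j * (S ** P ** transpose S) $ i $ j)"
      unfolding sum_mult_eq_trace[OF P] transpose_S by (simp add: matrix_mul_assoc)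
    have trS: "trace (P ** S) = (\<Sum>i\<in>?U. \<Sum>j\<in>?U. P $ i $ j * S $ i $ j)"
      by (rule sum_mult_eq_trace[OF P, symmetric])
    have 1: "(\<Sum>i\<in>?U. \<Sum>j\<in>?U. \<Sum>k'\<in>?U. \<Sum>l\<in>?U. P $ i $ j * P $ k' $ l * (S $ i $ j * S $ k' $ l)) = (trace (P ** S))\<^sup>2"
      unfolding trS power2_eq_square sum_distrib_right
      unfolding sum_distrib_left by (simp add: mult_ac)
    have 2: "(\<Sum>i\<in>?U. \<Sum>j\<in>?U. \<Sum>k'\<in>?U. \<Sum>l\<in>?U. P $ i $ j * P $ k' $ l * (S $ i $ k' * S $ j $ l)) = trace (P ** S ** P ** S)"
      unfolding tr SPS sum_distrib_left by (simp add: mult_ac)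
    have 3: "(\<Sum>i\<in>?U. \<Sum>j\<in>?U. \<Sum>k'\<in>?U. \<Sum>l\<in>?U. P $ i $ j * P $ k' $ l * (S $ i $ l * S $ j $ k')) = trace (P ** S ** P ** S)"
      unfolding tr SPS' sum_distrib_left by (simp add: mult_ac)
    show ?thesis
      unfolding distrib_left sum.distrib 1 2 3 by simp
  qed
  ultimately show ?thesis
    by simp
qed

text \<open>Both \<open>U\<close> and the costate are determined by the noise before
  \<open>w k\<close>, and their product is integrable by square integrability; the centered
  \<open>w k\<close> factors out. The case \<open>U = 1\<close> gives the mean, an earlier
  innovation as \<open>U\<close> gives orthogonality.\<close>

lemma has_integral_linear_mult:
  assumes U: "adapted k U" "integrable M (\<lambda>\<omega>. (U \<omega>)\<^sup>2)"
  shows "has_bochner_integral M (\<lambda>\<omega>. (w k \<omega> \<bullet> costate k \<omega>) * U \<omega>) 0"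
proof -
  have [measurable]: "U \<in> borel_measurable M" "(\<lambda>\<omega>. costate k \<omega> $ i) \<in> borel_measurable M" for i
    by (rule measurable_adapted[OF U(1)], rule measurable_adapted[OF adapted_costate])
  have "integrable M (\<lambda>\<omega>. costate k \<omega> $ i * U \<omega>)" for i
    using has_integral_costate2[of k i i] U(2)
    by (intro Bochner_Integration.integrable_bound[of _ "\<lambda>\<omega>. (costate k \<omega> $ i)\<^sup>2 + (U \<omega>)\<^sup>2" "\<lambda>\<omega>. costate k \<omega> $ i * U \<omega>"])
       (auto intro!: AE_I2 simp: has_bochner_integral_iff abs_mult_le_squares simp flip: power2_eq_square)
  then have "has_bochner_integral M (\<lambda>\<omega>. costate k \<omega> $ i * U \<omega>) (\<integral>\<omega>. costate k \<omega> $ i * U \<omega> \<partial>M)" for i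
    by (simp add: has_bochner_integral_iff)
  then have "has_bochner_integral M (\<lambda>\<omega>. \<Sum>i\<in>UNIV. w k \<omega> $ i * (costate k \<omega> $ i * U \<omega>))
      (\<Sum>i\<in>UNIV. 0 * (\<integral>\<omega>. costate k \<omega> $ i * U \<omega> \<partial>M))"
    by (intro has_bochner_integral_sum has_integral_indep_mult[where f = "\<lambda>v. v $ i" for i] has_integral_w
        adapted_mult adapted_costate U(1)) auto
  then show ?thesis
    unfolding inner_vec_def inner_real_def sum_distrib_right by (simp add: mult.assoc)
qed

lemma has_integral_linear: "has_bochner_integral M (\<lambda>\<omega>. w k \<omega> \<bullet> costate k \<omega>) 0"
  using has_integral_linear_mult[of k "\<lambda>_. 1"] by (simp add: adapted_const)

text \<open>The noise enters with degree three and independently of the costate, so vanishing third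
  moments suffice.\<close>

lemma has_integral_quadratic_linear:
  "has_bochner_integral M (\<lambda>\<omega>. (w k \<omega> \<bullet> (P *v w k \<omega>)) * (w k \<omega> \<bullet> costate k \<omega>)) 0"
proof -
  have "has_bochner_integral M (\<lambda>\<omega>. \<Sum>i\<in>UNIV. \<Sum>j\<in>UNIV. \<Sum>l\<in>UNIV. P $ i $ j * ((w k \<omega> $ i * w k \<omega> $ j * w k \<omega> $ l) * costate k \<omega> $ l))
     (\<Sum>i\<in>UNIV. \<Sum>j\<in>UNIV. \<Sum>l\<in>UNIV. P $ i $ j * (0 * (\<integral>\<omega>. costate k \<omega> $ l \<partial>M)))"
    by (intro has_bochner_integral_sum has_bochner_integral_mult_right
        has_integral_indep_mult[where f = "\<lambda>v. v $ i * v $ j * v $ l" for i j l] has_integral_w3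
        adapted_costate has_integral_costate) auto
  then show ?thesis
    unfolding quadratic_form_eq inner_vec_def[of _ "costate _ _"] sum_distrib_right
    unfolding sum_distrib_left by (simp add: mult_ac)
qed

text \<open>By independence this is the Frobenius pairing of \<open>S\<close> with the second
  moments of the costate; cyclicity of the trace gives the stated form.\<close>

lemma has_integral_linear_power2:
  "has_bochner_integral M (\<lambda>\<omega>. (w k \<omega> \<bullet> costate k \<omega>)\<^sup>2) (trace (P ** S ** P ** state_moment F x S k))"
proof -
  have "has_bochner_integral M (\<lambda>\<omega>. \<Sum>i\<in>UNIV. \<Sum>j\<in>UNIV. (w k \<omega> $ i * w k \<omega> $ j) * (costate k \<omega> $ i * costate k \<omega> $ j))
     (\<Sum>i\<in>UNIV. \<Sum>j\<in>UNIV. S $ i $ j * costate_moment k $ i $ j)"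
    by (intro has_bochner_integral_sum has_integral_indep_mult[where f = "\<lambda>v. v $ i * v $ j" for i j] has_integral_w2
        adapted_mult adapted_costate has_integral_costate2) auto
  moreover have "(\<Sum>i\<in>UNIV. \<Sum>j\<in>UNIV. S $ i $ j * costate_moment k $ i $ j) = trace (P ** S ** P ** state_moment F x S k)"
    unfolding sum_mult_eq_trace[OF transpose_S] P
    using trace_mul_sym[of "S ** P ** state_moment F x S k" P] by (simp add: matrix_mul_assoc)
  ultimately show ?thesis
    by (simp add: inner_vec_def power2_eq_square sum_product mult_ac)
qed

section \<open>Innovations: second moments and orthogonality\<close>

definition innovation :: "nat \<Rightarrow> 'a \<Rightarrow> real" where
  "innovation k \<omega> = w k \<omega> \<bullet> (P *v w k \<omega>) - trace (P ** S) + 2 * (w k \<omega> \<bullet> costate k \<omega>)"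

lemma has_integral_innovation: "has_bochner_integral M (innovation k) 0"
proof -
  have "has_bochner_integral M (\<lambda>_. trace (P ** S)) (trace (P ** S))"
    by (simp add: has_bochner_integral_iff prob_space)
  then have "has_bochner_integral M (\<lambda>\<omega>. w k \<omega> \<bullet> (P *v w k \<omega>) - trace (P ** S) + 2 * (w k \<omega> \<bullet> costate k \<omega>))
    (trace (P ** S) - trace (P ** S) + 2 * 0)"
    by (intro has_bochner_integral_add has_bochner_integral_diff has_bochner_integral_mult_right
        has_integral_quadratic has_integral_linear)
  then show ?thesis
    by (simp add: innovation_def[abs_def])
qed

text \<open>After expansion the squares of \<open>trace (P ** S)\<close> cancel, and the mixed terms
  of the quadratic and the linear part vanish.\<close>

lemma has_integral_innovation_power2:
  "has_bochner_integral M (\<lambda>\<omega>. (innovation k \<omega>)\<^sup>2)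
     (2 * trace (P ** S ** P ** S) + 4 * trace (P ** S ** P ** state_moment F x S k))"
proof -
  define t where "t = trace (P ** S)"
  have t: "has_bochner_integral M (\<lambda>_. t\<^sup>2) (t\<^sup>2)"
    by (simp add: has_bochner_integral_iff prob_space)
  let ?a = "\<lambda>\<omega>. w k \<omega> \<bullet> (P *v w k \<omega>)" and ?b = "\<lambda>\<omega>. w k \<omega> \<bullet> costate k \<omega>"
  have "has_bochner_integral M (\<lambda>\<omega>. (?a \<omega>)\<^sup>2 - 2 * t * ?a \<omega> + t\<^sup>2 + 4 * (?a \<omega> * ?b \<omega>) - 4 * t * ?b \<omega> + 4 * (?b \<omega>)\<^sup>2)
    ((t\<^sup>2 + 2 * trace (P ** S ** P ** S)) - 2 * t * t + t\<^sup>2 + 4 * 0 - 4 * t * 0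
      + 4 * trace (P ** S ** P ** state_moment F x S k))"
    unfolding t_def
    by (intro has_bochner_integral_add has_bochner_integral_diff has_bochner_integral_mult_right
        has_integral_quadratic has_integral_linear has_integral_quadratic_power2 has_integral_quadratic_linear
        has_integral_linear_power2 t[unfolded t_def])
  moreover have "(\<lambda>\<omega>. (?a \<omega>)\<^sup>2 - 2 * t * ?a \<omega> + t\<^sup>2 + 4 * (?a \<omega> * ?b \<omega>) - 4 * t * ?b \<omega> + 4 * (?b \<omega>)\<^sup>2) = (\<lambda>\<omega>. (innovation k \<omega>)\<^sup>2)"
    by (simp add: innovation_def t_def power2_eq_square algebra_simps)
  ultimately show ?thesis
    by (simp add: power2_eq_square)
qed

lemma adapted_innovation:
  assumes "l < k"
  shows "adapted k (innovation l)"
proof -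
  have "adapted k (\<lambda>\<omega>. costate l \<omega> $ i)" for i
    by (rule adapted_mono[OF adapted_costate]) (use assms in simp)
  then have "adapted k (\<lambda>\<omega>. (\<Sum>i\<in>UNIV. \<Sum>j\<in>UNIV. P $ i $ j * (w l \<omega> $ i * w l \<omega> $ j)) + - trace (P ** S)
     + 2 * (\<Sum>i\<in>UNIV. w l \<omega> $ i * costate l \<omega> $ i))"
    by (intro adapted_add adapted_mult adapted_sum adapted_const adapted_w assms)
  then show ?thesis
    by (simp add: innovation_def[abs_def] quadratic_form_eq inner_vec_def[of _ "costate _ _"])
qed

text \<open>The innovation at \<open>l\<close> is determined by the noise before \<open>w k\<close>.
  The centered quadratic part at \<open>k\<close> is independent of it, and the linear part is
  covered by \<open>has_integral_linear_mult\<close>.\<close>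

lemma innovation_orthogonal:
  assumes "l < k"
  shows "(\<integral>\<omega>. innovation k \<omega> * innovation l \<omega> \<partial>M) = 0"
proof -
  note l = adapted_innovation[OF assms] has_integral_innovation_power2[of l]
  have "has_bochner_integral M (\<lambda>\<omega>. w k \<omega> \<bullet> (P *v w k \<omega>) - trace (P ** S)) (trace (P ** S) - trace (P ** S))"
    by (intro has_bochner_integral_diff has_integral_quadratic) (simp add: has_bochner_integral_iff prob_space)
  then have "has_bochner_integral M (\<lambda>\<omega>. (w k \<omega> \<bullet> (P *v w k \<omega>) - trace (P ** S)) * innovation l \<omega>) ((trace (P ** S) - trace (P ** S)) * 0)"
    by (intro has_integral_indep_mult[where f = "\<lambda>v. v \<bullet> (P *v v) - trace (P ** S)"] l has_integral_innovation)
       (auto simp: quadratic_form_eq intro!: borel_measurable_continuous_onI continuous_intros)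
  moreover have "has_bochner_integral M (\<lambda>\<omega>. 2 * ((w k \<omega> \<bullet> costate k \<omega>) * innovation l \<omega>)) (2 * 0)"
    by (intro has_bochner_integral_mult_right has_integral_linear_mult l) (use l in \<open>simp add: has_bochner_integral_iff\<close>)
  ultimately have "has_bochner_integral M (\<lambda>\<omega>. (w k \<omega> \<bullet> (P *v w k \<omega>) - trace (P ** S)) * innovation l \<omega>
      + 2 * ((w k \<omega> \<bullet> costate k \<omega>) * innovation l \<omega>)) ((trace (P ** S) - trace (P ** S)) * 0 + 2 * 0)"
    by (rule has_bochner_integral_add)
  then show ?thesis
    by (simp add: innovation_def[of k] has_bochner_integral_iff algebra_simps)
qed

end

end

section \<open>The random return\<close>

lemma linear_congruence: "linear (\<lambda>X. N ** X ** transpose N)" for N :: "real^'n^'n"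
  by (intro linearI) (simp_all add: matrix_add_ldistrib matrix_mul_add_rdistrib matrix_mul_scaleR_left
        matrix_mul_scaleR_right)

lemma linear_trace_mult: "linear (\<lambda>X. trace (N ** X))" for N :: "real^'n^'n"
  by (intro linearI) (simp_all add: matrix_add_ldistrib matrix_mul_scaleR_right trace_def sum.distrib sum_distrib_left)

text \<open>The unrolled recursion consists of congruences by powers of \<open>F\<close>, each of
  which \<open>norm_congruence_le\<close> bounds uniformly.\<close>

lemma state_moment_eq:
  "state_moment F x S k = matpow F (Suc k) ** outer_product x x ** transpose (matpow F (Suc k))
     + (\<Sum>j<k. matpow F (Suc j) ** S ** transpose (matpow F (Suc j)))"
proof (induction k)
  case 0
  show ?case by (simp add: matpow_Suc)
next
  case (Suc k)
  have "F ** (\<Sum>j<k. matpow F (Suc j) ** S ** transpose (matpow F (Suc j))) ** transpose F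
      = (\<Sum>j<k. matpow F (Suc (Suc j)) ** S ** transpose (matpow F (Suc (Suc j))))"
    unfolding linear_sum[OF linear_congruence] matpow_congruence_step ..
  moreover have "F ** S ** transpose F = matpow F (Suc 0) ** S ** transpose (matpow F (Suc 0))"
    by (simp add: matpow_Suc)
  ultimately show ?case
    unfolding state_moment.simps Suc.IH linear_add[OF linear_congruence] matpow_congruence_step
      sum.lessThan_Suc_shift[of _ k]
    by (simp only: ac_simps)
qed

text \<open>The moments grow at most linearly in \<open>k\<close>, and the series of
  \<open>(k + 1) * c ^ k\<close> converges.\<close>

lemma summable_state_moment:
  fixes F :: "real^'n^'n"
  assumes bd: "\<And>k i j. \<bar>matpow F k $ i $ j\<bar> \<le> C" and c: "0 \<le> c" "c < 1"
  shows "summable (\<lambda>k. c ^ k *\<^sub>R state_moment F x S k)"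
proof -
  define L where "L = (\<lambda>X::real^'n^'n. (real CARD('n))\<^sup>2 * (C\<^sup>2 * (\<Sum>a\<in>UNIV. \<Sum>b\<in>UNIV. \<bar>X $ a $ b\<bar>)))"
  have L: "norm (matpow F k ** X ** transpose (matpow F k)) \<le> L X" for k X
    unfolding L_def by (rule norm_congruence_le) (rule bd)
  have L0: "0 \<le> L X" for X
    using order.trans[OF norm_ge_zero L] .
  have bound: "norm (state_moment F x S k) \<le> of_nat (Suc k) * (L (outer_product x x) + L S)" for k
  proof -
    have "norm (state_moment F x S k) \<le> L (outer_product x x) + (\<Sum>j<k. L S)"
      unfolding state_moment_eq by (intro order.trans[OF norm_triangle_ineq] add_mono L sum_norm_le)
    also have "\<dots> \<le> of_nat (Suc k) * (L (outer_product x x) + L S)"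
      using L0[of S] mult_nonneg_nonneg[OF of_nat_0_le_iff[of k] L0[of "outer_product x x"]] by (simp add: algebra_simps)
    finally show ?thesis .
  qed
  have "summable (\<lambda>k. of_nat (Suc k) * c ^ k * (L (outer_product x x) + L S))"
    by (rule summable_mult2, rule sums_summable, rule geometric_deriv_sums) (use c in simp)
  then show ?thesis
  proof (rule summable_comparison_test'[where N = 0])
    fix k
    have "c ^ k * norm (state_moment F x S k) \<le> c ^ k * (of_nat (Suc k) * (L (outer_product x x) + L S))"
      using c by (intro mult_left_mono bound) simp
    then show "norm (c ^ k *\<^sub>R state_moment F x S k) \<le> of_nat (Suc k) * c ^ k * (L (outer_product x x) + L S)"
      using c by (simp add: mult_ac)
  qed
qed

text \<open>Applying \<open>c *\<^sub>R \<Phi>\<close> to the series with \<open>S\<close> added to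
  every moment shifts it by one index; the missing first term is the congruence of
  \<open>outer_product x x\<close>. The added copies of \<open>S\<close> sum to
  \<open>1 / (1 - c)\<close> times \<open>S\<close>, and the outer \<open>c\<close> gives
  \<open>c / (1 - c)\<close>.\<close>

lemma state_moment_sums_fixpoint:
  fixes F S :: "real^'n^'n" and x :: "real^'n"
  assumes bd: "\<And>k i j. \<bar>matpow F k $ i $ j\<bar> \<le> C" and c: "0 \<le> c" "c < 1"
  defines "Z \<equiv> \<Sum>k. c ^ k *\<^sub>R state_moment F x S k"
  shows "Z - c *\<^sub>R (F ** Z ** transpose F) = F ** (outer_product x x + (c / (1 - c)) *\<^sub>R S) ** transpose F"
proof -
  note s = summable_state_moment[OF bd c, of x S]
  define \<Phi> where "\<Phi> = (\<lambda>X. F ** X ** transpose F)"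
  have lin: "linear \<Phi>"
    unfolding \<Phi>_def by (rule linear_congruence)
  then have bl: "bounded_linear \<Phi>"
    by (simp add: linear_conv_bounded_linear)
  have "(\<lambda>k. c ^ k) sums (1 / (1 - c))"
    using c by (intro geometric_sums) simp
  then have "(\<lambda>k. c ^ k *\<^sub>R S) sums ((1 / (1 - c)) *\<^sub>R S)"
    by (rule sums_scaleR_left)
  then have "(\<lambda>k. c ^ k *\<^sub>R state_moment F x S k + c ^ k *\<^sub>R S) sums (Z + (1 / (1 - c)) *\<^sub>R S)"
    unfolding Z_def by (intro sums_add summable_sums[OF s])
  then have "(\<lambda>k. c *\<^sub>R \<Phi> (c ^ k *\<^sub>R state_moment F x S k + c ^ k *\<^sub>R S)) sums (c *\<^sub>R \<Phi> (Z + (1 / (1 - c)) *\<^sub>R S))"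
    by (intro sums_scaleR_right bounded_linear.sums[OF bl])
  moreover have "c *\<^sub>R \<Phi> (c ^ k *\<^sub>R state_moment F x S k + c ^ k *\<^sub>R S) = c ^ Suc k *\<^sub>R state_moment F x S (Suc k)" for k
    by (simp add: linear_cmul[OF lin] flip: scaleR_add_right) (simp add: \<Phi>_def)
  ultimately have "(\<lambda>k. c ^ Suc k *\<^sub>R state_moment F x S (Suc k)) sums (c *\<^sub>R \<Phi> (Z + (1 / (1 - c)) *\<^sub>R S))"
    by simp
  then have "(\<lambda>k. c ^ k *\<^sub>R state_moment F x S k) sums (c *\<^sub>R \<Phi> (Z + (1 / (1 - c)) *\<^sub>R S) + c ^ 0 *\<^sub>R state_moment F x S 0)"
    by (subst (asm) sums_Suc_iff) simp
  then have "Z = c *\<^sub>R \<Phi> (Z + (1 / (1 - c)) *\<^sub>R S) + \<Phi> (outer_product x x)"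
    unfolding Z_def by (simp add: sums_iff \<Phi>_def)
  then have "Z - c *\<^sub>R \<Phi> Z = \<Phi> (outer_product x x + (c / (1 - c)) *\<^sub>R S)"
    by (simp add: linear_add[OF lin] linear_cmul[OF lin] scaleR_add_right algebra_simps)
  then show ?thesis
    by (simp only: \<Phi>_def)
qed

text \<open>The double transpose puts the equation into the shape of
  \<open>discounted_equation_ex1\<close> with the transposed closed-loop matrix as
  \<open>N\<close>.\<close>

lemma is_P_solution_iff:
  "is_P_solution A B Q R \<gamma> K P \<longleftrightarrow>
     P - \<gamma> *\<^sub>R (transpose (A + B ** K) ** P ** transpose (transpose (A + B ** K))) = Q + transpose K ** R ** K"
  by (auto simp: is_P_solution_def algebra_simps)

text \<open>Transposing the equation reproduces it; with uniqueness this makes the solution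
  symmetric.\<close>

lemma is_P_solution_transpose:
  assumes "transpose Q = Q" "transpose R = R" "is_P_solution A B Q R \<gamma> K P"
  shows "is_P_solution A B Q R \<gamma> K (transpose P)"
  using arg_cong[OF assms(3)[unfolded is_P_solution_def], of transpose] assms(1,2)
  unfolding is_P_solution_def
  by (simp only: transpose_add transpose_scaleR matrix_transpose_mul transpose_transpose matrix_mul_assoc)

lemma discounted_const_sums:
  fixes \<gamma> t :: real
  assumes "0 < \<gamma>" "\<gamma> < 1"
  shows "(\<lambda>k. \<gamma> ^ (k + 1) * t) sums (\<gamma> / (1 - \<gamma>) * t)"
  using sums_mult2[OF sums_mult[OF geometric_sums[of \<gamma>], of \<gamma>], of t] assms by simp

section \<open>Convergence, centering and variance of the return\<close>

context gaussian_noise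
begin

context
  fixes P F :: "real^'n^'n" and \<gamma> :: real and C :: real
  assumes P: "transpose P = P" and bd: "\<And>k i j. \<bar>matpow F k $ i $ j\<bar> \<le> C"
    and g: "0 < \<gamma>" "\<gamma> < 1"
begin

text \<open>The image of the summable matrix series under a linear functional. The first power of
  \<open>\<gamma>\<close> is the weight that \<open>AE_discounted_summable\<close> asks for.\<close>

lemma summable_discounted_trace:
  "summable (\<lambda>k. \<gamma> ^ (k + 1) * trace (P ** S ** P ** state_moment F x S k))"
proof -
  have "summable (\<lambda>k. trace (P ** S ** P ** (\<gamma> ^ k *\<^sub>R state_moment F x S k)))"
    using g linear_trace_mult[of "P ** S ** P"]
    by (intro bounded_linear.summable[of "\<lambda>X. trace (P ** S ** P ** X)"] summable_state_moment[OF bd])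
       (simp_all add: linear_conv_bounded_linear)
  from summable_mult[OF this, of \<gamma>] show ?thesis
    by (simp add: linear_cmul[OF linear_trace_mult] mult.assoc)
qed

lemma measurable_linear [measurable]:
  "(\<lambda>\<omega>. w k \<omega> \<bullet> (P *v state F x (\<lambda>j. w j \<omega>) k)) \<in> borel_measurable M"
  by (rule borel_measurable_integrable, rule integrable.intros, rule has_integral_linear[OF P])

lemma measurable_quadratic [measurable]: "(\<lambda>\<omega>. w k \<omega> \<bullet> (P *v w k \<omega>)) \<in> borel_measurable M"
  by (rule borel_measurable_integrable, rule integrable.intros, rule has_integral_quadratic[OF P])

lemma AE_linear_summable:
  "AE \<omega> in M. summable (\<lambda>k. \<gamma> ^ (k + 1) * (w k \<omega> \<bullet> (P *v state F x (\<lambda>j. w j \<omega>) k)))"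
  by (rule AE_discounted_summable[OF g measurable_linear])
     (use has_integral_linear_power2[OF P] summable_discounted_trace in \<open>simp_all add: has_bochner_integral_iff\<close>)

lemma AE_quadratic_summable: "AE \<omega> in M. summable (\<lambda>k. \<gamma> ^ (k + 1) * (w k \<omega> \<bullet> (P *v w k \<omega>)))"
  using integrable.intros[OF has_integral_quadratic_power2[OF P]] sums_summable[OF discounted_const_sums[OF g]]
  by (intro AE_discounted_summable[OF g measurable_quadratic])
     (simp_all only: has_bochner_integral_integral_eq[OF has_integral_quadratic_power2[OF P]])

text \<open>The state is affine in its initial value, so the part driven by \<open>x\<close> is the
  difference of the states started at \<open>x\<close> and at 0. Convergence then follows from
  \<open>AE_linear_summable\<close> at both starting points.\<close>

lemma return_term1_eq:
  "return_term1 \<gamma> P F x (\<lambda>j. w j \<omega>) = (\<lambda>k. \<gamma> ^ (k + 1) * (w k \<omega> \<bullet> (P *v state F x (\<lambda>j. w j \<omega>) k))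
     - \<gamma> ^ (k + 1) * (w k \<omega> \<bullet> (P *v state F 0 (\<lambda>j. w j \<omega>) k)))"
  unfolding return_term1_def state_eq
  by (simp add: fun_eq_iff matrix_vector_right_distrib inner_add_right distrib_left)

lemma return_term3_eq:
  "return_term3 \<gamma> P F (\<lambda>j. w j \<omega>) = (\<lambda>k. \<gamma> ^ (k + 1) * (w k \<omega> \<bullet> (P *v state F 0 (\<lambda>j. w j \<omega>) k)))"
  unfolding return_term3_def state_eq by simp

lemma AE_return_terms_summable:
  "AE \<omega> in M. summable (return_term1 \<gamma> P F x (\<lambda>j. w j \<omega>)) \<and> summable (return_term2 \<gamma> P (\<lambda>j. w j \<omega>))
     \<and> summable (\<lambda>k. return_term3 \<gamma> P F (\<lambda>j. w j \<omega>) (Suc k))"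
  using AE_linear_summable[of x] AE_linear_summable[of 0] AE_quadratic_summable
proof eventually_elim
  case (elim \<omega>)
  have "summable (return_term3 \<gamma> P F (\<lambda>j. w j \<omega>))"
    unfolding return_term3_eq by (rule elim(2))
  moreover have "summable (return_term1 \<gamma> P F x (\<lambda>j. w j \<omega>))"
    unfolding return_term1_eq by (intro summable_diff elim(1,2))
  moreover have "summable (return_term2 \<gamma> P (\<lambda>j. w j \<omega>))"
    unfolding return_term2_def[abs_def] by (rule elim(3))
  ultimately show ?case
    by (simp add: summable_Suc_iff)
qed

text \<open>Where the three series converge they may be added termwise. Centering each quadratic
  term by \<open>trace (P ** S)\<close> is compensated by a geometric series.\<close>

lemma AE_random_return_eq:
  "AE \<omega> in M. random_return \<gamma> P F x w \<omega> =
     x \<bullet> (P *v x) + \<gamma> / (1 - \<gamma>) * trace (P ** S) + (\<Sum>k. \<gamma> ^ (k + 1) * innovation P F x k \<omega>)"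
  using AE_return_terms_summable[of x]
proof eventually_elim
  case (elim \<omega>)
  let ?u = "\<lambda>j. w j \<omega>"
  have s1: "return_term1 \<gamma> P F x ?u sums (\<Sum>k. return_term1 \<gamma> P F x ?u k)"
    and s2: "return_term2 \<gamma> P ?u sums (\<Sum>k. return_term2 \<gamma> P ?u k)"
    using elim by (simp_all add: summable_sums)
  have "(\<lambda>k. return_term3 \<gamma> P F ?u (Suc k)) sums (\<Sum>k. return_term3 \<gamma> P F ?u (Suc k))"
    using elim by (simp add: summable_sums)
  \<comment> \<open>The term of index 0 is an empty sum, so starting at 0 instead of 1 does not
    change the value.\<close>
  then have s3: "return_term3 \<gamma> P F ?u sums (\<Sum>k. return_term3 \<gamma> P F ?u (Suc k))"
    by (subst (asm) sums_Suc_iff) (simp add: return_term3_def)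
  have "(\<lambda>k. 2 * return_term1 \<gamma> P F x ?u k + return_term2 \<gamma> P ?u k + 2 * return_term3 \<gamma> P F ?u k - \<gamma> ^ (k + 1) * trace (P ** S))
    sums (2 * (\<Sum>k. return_term1 \<gamma> P F x ?u k) + (\<Sum>k. return_term2 \<gamma> P ?u k)
      + 2 * (\<Sum>k. return_term3 \<gamma> P F ?u (Suc k)) - \<gamma> / (1 - \<gamma>) * trace (P ** S))"
    by (intro sums_add sums_diff sums_mult s1 s2 s3 discounted_const_sums g)
  moreover have "2 * return_term1 \<gamma> P F x ?u k + return_term2 \<gamma> P ?u k + 2 * return_term3 \<gamma> P F ?u k - \<gamma> ^ (k + 1) * trace (P ** S)
    = \<gamma> ^ (k + 1) * innovation P F x k \<omega>" for k
    unfolding return_term1_eq return_term3_eq return_term2_def innovation_def[OF P] by (simp add: algebra_simps)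
  ultimately show ?case
    by (simp add: random_return_def sums_iff)
qed

lemma measurable_random_return: "random_return \<gamma> P F x w \<in> borel_measurable M"
  unfolding random_return_def[abs_def] return_term1_eq return_term3_eq return_term2_def by measurable

text \<open>Almost surely the return is a constant plus the orthogonal series of innovations, so its
  variance is the sum of their discounted second moments. \<open>Z\<close> is the explicit series
  here; its equation enters only in the theorem.\<close>

lemma random_return_moments:
  fixes x :: "real^'n"
  defines "Z \<equiv> \<Sum>k. (\<gamma>\<^sup>2) ^ k *\<^sub>R state_moment F x S k"
  shows "integrable M (random_return \<gamma> P F x w)"
    and "integrable M (\<lambda>\<omega>. (random_return \<gamma> P F x w \<omega>)\<^sup>2)"
    and "variance (random_return \<gamma> P F x w)
      = 2 * \<gamma>\<^sup>2 / (1 - \<gamma>\<^sup>2) * trace (P ** S ** P ** S) + 4 * \<gamma>\<^sup>2 * trace (P ** S ** P ** Z)"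
proof -
  define D where "D = (\<lambda>\<omega>. \<Sum>k. \<gamma> ^ (k + 1) * innovation P F x k \<omega>)"
  define c where "c = x \<bullet> (P *v x) + \<gamma> / (1 - \<gamma>) * trace (P ** S)"
  note I = has_integral_innovation[OF P, of F x] has_integral_innovation_power2[OF P, of F x]
  have "summable (\<lambda>k. 2 * trace (P ** S ** P ** S) * \<gamma> ^ (k + 1) + 4 * (\<gamma> ^ (k + 1) * trace (P ** S ** P ** state_moment F x S k)))"
    using sums_summable[OF discounted_const_sums[OF g, of "2 * trace (P ** S ** P ** S)"]]
    unfolding mult.commute[of _ "2 * trace (P ** S ** P ** S)"]
    by (intro summable_add summable_mult[of _ 4] summable_discounted_trace)
  then have s: "summable (\<lambda>k. \<gamma> ^ (k + 1) * (\<integral>\<omega>. (innovation P F x k \<omega>)\<^sup>2 \<partial>M))"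
    using I by (simp add: has_bochner_integral_iff algebra_simps)
  have D: "integrable M D" "integrable M (\<lambda>\<omega>. (D \<omega>)\<^sup>2)" "(\<integral>\<omega>. D \<omega> \<partial>M) = 0"
    "(\<lambda>k. \<gamma> ^ (2 * (k + 1)) * (\<integral>\<omega>. (innovation P F x k \<omega>)\<^sup>2 \<partial>M)) sums (\<integral>\<omega>. (D \<omega>)\<^sup>2 \<partial>M)"
    unfolding D_def
    by (rule discounted_orthogonal_series[OF g _ _ s prob_space_axioms];
        use I innovation_orthogonal[OF P] in \<open>auto simp: has_bochner_integral_iff\<close>)+
  have ae: "AE \<omega> in M. random_return \<gamma> P F x w \<omega> = c + D \<omega>"
    using AE_random_return_eq by (simp add: c_def D_def)
  note [measurable] = measurable_random_return borel_measurable_integrable[OF D(1)]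
  have cD: "has_bochner_integral M (\<lambda>\<omega>. c + D \<omega>) c"
    using D by (simp add: has_bochner_integral_iff prob_space)
  have cD2: "integrable M (\<lambda>\<omega>. (c + D \<omega>)\<^sup>2)"
    using D by (simp add: power2_sum)
  show "integrable M (random_return \<gamma> P F x w)"
    by (subst integrable_cong_AE[OF _ _ ae]) (use cD in \<open>auto simp: has_bochner_integral_iff\<close>)
  show "integrable M (\<lambda>\<omega>. (random_return \<gamma> P F x w \<omega>)\<^sup>2)"
    by (subst integrable_cong_AE[where g = "\<lambda>\<omega>. (c + D \<omega>)\<^sup>2"]) (use ae cD2 in auto)
  have "expectation (random_return \<gamma> P F x w) = c"
    by (subst integral_cong_AE[OF _ _ ae]) (use cD in \<open>auto simp: has_bochner_integral_iff\<close>)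
  then have "variance (random_return \<gamma> P F x w) = (\<integral>\<omega>. (D \<omega>)\<^sup>2 \<partial>M)"
    by (intro integral_cong_AE) (use ae in auto)
  moreover have "(\<lambda>k. \<gamma> ^ (2 * (k + 1)) * (\<integral>\<omega>. (innovation P F x k \<omega>)\<^sup>2 \<partial>M))
     sums (2 * \<gamma>\<^sup>2 / (1 - \<gamma>\<^sup>2) * trace (P ** S ** P ** S) + 4 * \<gamma>\<^sup>2 * trace (P ** S ** P ** Z))"
  proof -
    have g2: "0 < \<gamma>\<^sup>2" "\<gamma>\<^sup>2 < 1"
      using g by (simp_all add: power_less_one_iff)
    have "(\<lambda>k. (\<gamma>\<^sup>2) ^ k *\<^sub>R state_moment F x S k) sums Z"
      unfolding Z_def using g2 by (intro summable_sums summable_state_moment[OF bd]) auto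
    then have "(\<lambda>k. trace (P ** S ** P ** ((\<gamma>\<^sup>2) ^ k *\<^sub>R state_moment F x S k))) sums trace (P ** S ** P ** Z)"
      using linear_trace_mult[of "P ** S ** P"]
      by (intro bounded_linear.sums[of "\<lambda>X. trace (P ** S ** P ** X)"]) (simp_all add: linear_conv_bounded_linear)
    then have "(\<lambda>k. (\<gamma>\<^sup>2) ^ (k + 1) * (2 * trace (P ** S ** P ** S))
        + 4 * \<gamma>\<^sup>2 * trace (P ** S ** P ** ((\<gamma>\<^sup>2) ^ k *\<^sub>R state_moment F x S k)))
      sums (\<gamma>\<^sup>2 / (1 - \<gamma>\<^sup>2) * (2 * trace (P ** S ** P ** S)) + 4 * \<gamma>\<^sup>2 * trace (P ** S ** P ** Z))"
      by (intro sums_add sums_mult discounted_const_sums g2)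
    \<comment> \<open>In the second summand one factor \<open>\<gamma>\<^sup>2\<close> is pulled
      out, because the series for \<open>Z\<close> starts with weight 1.\<close>
    moreover have "(\<gamma>\<^sup>2) ^ (k + 1) * (2 * trace (P ** S ** P ** S))
        + 4 * \<gamma>\<^sup>2 * trace (P ** S ** P ** ((\<gamma>\<^sup>2) ^ k *\<^sub>R state_moment F x S k))
      = \<gamma> ^ (2 * (k + 1)) * (\<integral>\<omega>. (innovation P F x k \<omega>)\<^sup>2 \<partial>M)" for k
      using I(2)[of k] unfolding power_mult
      by (simp add: has_bochner_integral_iff linear_cmul[OF linear_trace_mult] algebra_simps)
    ultimately show ?thesis
      by (simp add: mult_ac)
  qed
  ultimately show "variance (random_return \<gamma> P F x w)
      = 2 * \<gamma>\<^sup>2 / (1 - \<gamma>\<^sup>2) * trace (P ** S ** P ** S) + 4 * \<gamma>\<^sup>2 * trace (P ** S ** P ** Z)"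
    using sums_unique2[OF D(4)] by simp
qed

end

end

theorem theorem2:
  fixes A Q \<Sigma> P Z :: "real^'n^'n" and B :: "real^'m^'n" and R :: "real^'m^'m"
    and K :: "real^'n^'m" and \<gamma> :: real and x :: "real^'n"
    and M :: "'a measure" and w :: "nat \<Rightarrow> 'a \<Rightarrow> real^'n"
  assumes "pos_def Q" and "pos_def R"
    and "0 < \<gamma>" and "\<gamma> < 1"
    and "spectral_radius (A + B ** K) < 1"
    and "prob_space M"
    and "prob_space.indep_vars M (\<lambda>_. borel) w UNIV"
    and "\<And>k l. distr M borel (w k) = distr M borel (w l)"
    and "\<And>k. gaussian_vector M (w k)"
    and "\<And>k. (\<integral>\<omega>. w k \<omega> \<partial>M) = 0"
    and "\<And>k. covariance_matrix M (w k) = \<Sigma>"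
    and "pos_def \<Sigma>"
    and "P = (THE P'. is_P_solution A B Q R \<gamma> K P')"
    and "Z = (THE Z'. is_Z_solution A B \<gamma> K \<Sigma> x Z')"
  shows "(\<exists>!P'. is_P_solution A B Q R \<gamma> K P')
    \<and> (\<exists>!Z'. is_Z_solution A B \<gamma> K \<Sigma> x Z')
    \<and> (AE \<omega> in M. summable (return_term1 \<gamma> P (A + B ** K) x (\<lambda>j. w j \<omega>))
                \<and> summable (return_term2 \<gamma> P (\<lambda>j. w j \<omega>))
                \<and> summable (\<lambda>k. return_term3 \<gamma> P (A + B ** K) (\<lambda>j. w j \<omega>) (Suc k)))
    \<and> integrable M (random_return \<gamma> P (A + B ** K) x w)
    \<and> integrable M (\<lambda>\<omega>. (random_return \<gamma> P (A + B ** K) x w \<omega>)\<^sup>2)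
    \<and> prob_space.variance M (random_return \<gamma> P (A + B ** K) x w)
        = 2 * \<gamma>\<^sup>2 / (1 - \<gamma>\<^sup>2) * trace (P ** \<Sigma> ** P ** \<Sigma>)
          + 4 * \<gamma>\<^sup>2 * trace (P ** \<Sigma> ** P ** Z)"
proof -
  define F where "F = A + B ** K"
  interpret prob_space M by fact
  interpret gaussian_noise M w \<Sigma>
    by unfold_locales (use assms in \<open>auto intro!: centered_gaussian.intro centered_gaussian_axioms.intro\<close>)
  obtain C where bd: "\<And>k i j. \<bar>matpow F k $ i $ j\<bar> \<le> C"
    using matpow_bounded assms(5) unfolding F_def by blast
  \<comment> \<open>The equation for \<open>P\<close> involves congruences by the transposed matrix,
    so its powers must be bounded as well.\<close>
  have bd': "\<bar>matpow (transpose F) k $ i $ j\<bar> \<le> C" for k i j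
    using bd[of k j i] unfolding transpose_matpow[symmetric] by (simp add: transpose_def)
  have g2: "0 \<le> \<gamma>\<^sup>2" "\<gamma>\<^sup>2 < 1"
    using assms(3,4) by (simp_all add: power_less_one_iff)
  have P_ex1: "\<exists>!P'. is_P_solution A B Q R \<gamma> K P'"
    unfolding is_P_solution_iff F_def[symmetric] by (rule discounted_equation_ex1[OF bd']) (use assms in auto)
  have Z_ex1: "\<exists>!Z'. is_Z_solution A B \<gamma> K \<Sigma> x Z'"
    unfolding is_Z_solution_def F_def[symmetric] by (rule discounted_equation_ex1[OF bd g2])
  have "is_P_solution A B Q R \<gamma> K P"
    unfolding assms(13) by (rule theI'[OF P_ex1])
  \<comment> \<open>The transpose of \<open>P\<close> solves the same equation, hence equals
    \<open>P\<close> by uniqueness.\<close>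
  then have P: "transpose P = P"
    using is_P_solution_transpose[of Q R A B \<gamma> K P] P_ex1 assms(1,2) by (auto simp: pos_def_def)
  have "is_Z_solution A B \<gamma> K \<Sigma> x (\<Sum>k. (\<gamma>\<^sup>2) ^ k *\<^sub>R state_moment F x \<Sigma> k)"
    unfolding is_Z_solution_def F_def[symmetric] by (rule state_moment_sums_fixpoint[OF bd g2])
  \<comment> \<open>Uniqueness identifies the definite description with the explicit series.\<close>
  then have Z: "Z = (\<Sum>k. (\<gamma>\<^sup>2) ^ k *\<^sub>R state_moment F x \<Sigma> k)"
    unfolding assms(14) by (rule the1_equality[OF Z_ex1])
  show ?thesis
    unfolding F_def[symmetric] Z
    using P_ex1 Z_ex1[unfolded Z] AE_return_terms_summable[OF P bd assms(3,4)] random_return_moments[OF P bd assms(3,4)]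
    by (intro conjI)
qed

end
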